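(* Assume the setting of the context, including the local Poincaré assumption and the surjectivity assumption. Consider $PW_\omega(\mathcal{L})$, $\omega>0$, and (sufficiently small) $\rho<(C_1\omega)^{-1}$, where $C_1=2^{1/k}C_0^{1/2}<2C_0^{1/2}$ with $C_0=C\,N(\mathbf{X})$ is the constant of the spline approximation estimate recalled in the context. For every $\rho$-lattice $\{x_j\}$ and the corresponding set of functions $\xi_j=|B(x_j,\rho)|^{-1/2}\chi_{B(x_j,\rho)}$, every $f\in PW_\omega(\mathcal{L})$ is uniquely determined by the set of values $\{\langle f,\xi_j\rangle\}$ and can be reconstructed by the formula $$\lim_{k\to\infty}S_k(f)=f,$$ where the rate of convergence is $$\|f-S_k(f)\|\le\gamma^k\|f\|,\qquad\gamma=C_1\rho\omega<1 .$$
   Context: Setting. $(\mathbf{X},\mathrm{dist})$ is a metric space with locally compact separable topology, and $\mu$ is a positive Radon measure that is doubling: for some $D>0$, $0<|B(x,2r)|\le2^D|B(x,r)|$ for all $x\in\mathbf{X}$, $r>0$, where $B(x,r)$ is the open ball and $|B|=\mu(B)$. $\mathcal{L}$ is a non-negative self-adjoint operator, densely defined in the real Hilbert space $L_2(\mathbf{X})=L_2(\mathbf{X},\mu)$ (norm $\|\cdot\|$, inner product $\langle\cdot,\cdot\rangle$), whose associated symmetric bilinear form $\mathcal{E}$ (with $\mathcal{E}(f,g)=\langle\mathcal{L}f,g\rangle$ for $f,g\in\mathcal{D}(\mathcal{L})$) is a strongly local regular Dirichlet form with energy measure $d\Gamma(f,g)$, so $\mathcal{E}(f,g)=\int_{\mathbf{X}}d\Gamma(f,g)$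 and in particular $\|\mathcal{L}^{1/2}f\|^2=\mathcal{E}(f,f)=\int_{\mathbf{X}}d\Gamma(f,f)$ for $f\in\mathcal{D}(\mathcal{E})$. Local Poincaré assumption: there are constants $C>0$, $r_0>0$ such that for all $f\in\mathcal{D}(\mathcal{L})$, $x\in\mathbf{X}$, $0<r\le r_0$, with $B=B(x,r)$ and $f_B=|B|^{-1}\int_B f\,d\mu$, $$\int_B|f-f_B|^2d\mu\le Cr^2\int_B d\Gamma(f,f).$$ $\rho$-lattice: $N(\mathbf{X})$ is a fixed constant such that for every sufficiently small $\rho>0$ there is a set $\{x_j\}_{j\in J}\subset\mathbf{X}$ for which the balls $B(x_j,\rho/2)$ are pairwise disjoint and the balls $B(x_j,\rho)$ cover $\mathbf{X}$ with multiplicity at most $N(\mathbf{X})$. Any such set is called a $\rho$-lattice. $\chi_E$ is the characteristic function of $E$. Surjectivity assumption: there exists $k_0\in\mathbb{N}$ such that for every $k>k_0$ and every $\rho$-lattice with sufficiently small $\rho>0$, the map $\mathcal{D}(\mathcal{L}^{k/2})\to l_2$, $f\mapsto\{\langle f,\xi_j\rangle\}_{j\in J}$, has the entire $l_2$ as its image. Spline: for $k>k_0$ and $f\in\mathcal{D}(\mathcal{L}^{k/2})$, $S_k(f)$ denotes the unique minimizer of $u\mapsto\|\mathcal{L}^{k/2}u\|$ among all $u\in\mathcal{D}(\mathcal{L}^{k/2})$ with $\langle u,\xi_j\rangle=\langle f,\xi_j\rangle$ for all $j\in J$. Paley-Wiener space: $PW_\omega(\mathcal{L})$ is the range of the spectral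 projector $\mathbf{1}_{[0,\omega]}(\sqrt{\mathcal{L}})$, where $\mathbf{1}_{[0,\omega]}$ is the characteristic function of $[0,\omega]$; on it $\|\mathcal{L}^{s/2}f\|\le\omega^s\|f\|$ for $s\ge0$. Constant $C_1$: it is the constant of the estimate $\|f-S_k(f)\|^2\le(C_1\rho\omega)^{2k}\|f\|^2$ for $f\in PW_\omega(\mathcal{L})$, which is stated for $k=2^l$, $l\in\mathbb{N}$, with $C_1=2^{1/k}C_0^{1/2}<2C_0^{1/2}$ and $C_0=C\,N(\mathbf{X})$. *)

theory Defs
  imports "HOL-Analysis.Analysis"
begin

text \<open>The measure is a parameter of the type class, so that the space of square integrable
  functions modulo almost everywhere equality is a type.  The class only fixes the data; Radon
  regularity, doubling etc. are separate predicates.\<close>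

class metric_measure_space = metric_space +
  fixes mu :: "'a measure"
  assumes sets_mu: "sets mu = sets borel"

definition square_integrable :: "('a::metric_measure_space \<Rightarrow> real) \<Rightarrow> bool" where
  "square_integrable u \<longleftrightarrow> u \<in> borel_measurable mu \<and> integrable mu (\<lambda>x. (u x)\<^sup>2)"

lemma square_integrable_mult:
  assumes "square_integrable u" "square_integrable v"
  shows "integrable mu (\<lambda>x. u x * v x)"
proof (rule Bochner_Integration.integrable_bound)
  show "integrable mu (\<lambda>x. (u x)\<^sup>2 + (v x)\<^sup>2)"
    using assms by (simp add: square_integrable_def)
  show "(\<lambda>x. u x * v x) \<in> borel_measurable mu"
    using assms by (auto simp: square_integrable_def)
  have "\<bar>a * b\<bar> \<le> a\<^sup>2 + b\<^sup>2" for a b :: real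
  proof -
    have "2 * (\<bar>a\<bar> * \<bar>b\<bar>) \<le> a\<^sup>2 + b\<^sup>2"
      using sum_squares_bound[of "\<bar>a\<bar>" "\<bar>b\<bar>"] by (simp add: mult.assoc)
    moreover have "0 \<le> \<bar>a\<bar> * \<bar>b\<bar>" by simp
    ultimately show ?thesis by (simp only: abs_mult)
  qed
  then show "AE x in mu. norm (u x * v x) \<le> norm ((u x)\<^sup>2 + (v x)\<^sup>2)"
    by simp
qed

lemma square_integrable_zero: "square_integrable (\<lambda>x. 0)"
  by (simp add: square_integrable_def)

lemma square_integrable_add:
  assumes "square_integrable u" "square_integrable v"
  shows "square_integrable (\<lambda>x. u x + v x)"
proof -
  have "integrable mu (\<lambda>x. (u x)\<^sup>2 + (v x)\<^sup>2 + 2 * (u x * v x))"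
    using assms square_integrable_mult[OF assms]
    by (intro Bochner_Integration.integrable_add integrable_mult_right)
       (simp_all add: square_integrable_def)
  then show ?thesis
    using assms by (auto simp: square_integrable_def power2_sum mult.assoc)
qed

lemma square_integrable_scale: "square_integrable u \<Longrightarrow> square_integrable (\<lambda>x. c * u x)"
  by (auto simp: square_integrable_def power_mult_distrib)

quotient_type (overloaded) 'a l2 = "'a::metric_measure_space \<Rightarrow> real" / partial:
  "\<lambda>u v. square_integrable u \<and> square_integrable v \<and> (AE x in mu. u x = v x)"
proof (rule part_equivpI)
  show "\<exists>u. square_integrable u \<and> square_integrable u \<and> (AE x in mu. u x = u x)"
    using square_integrable_zero by (intro exI[of _ "\<lambda>x. 0"]) simp
  show "symp (\<lambda>u v. square_integrable u \<and> square_integrable v \<and> (AE x in mu. u x = v x))"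
    by (rule sympI) auto
  show "transp (\<lambda>u v. square_integrable u \<and> square_integrable v \<and> (AE x in mu. u x = v x))"
    by (rule transpI) auto
qed

instantiation l2 :: (metric_measure_space) real_inner
begin

lift_definition zero_l2 :: "'a l2" is "\<lambda>x. 0"
  by (simp add: square_integrable_zero)

lift_definition plus_l2 :: "'a l2 \<Rightarrow> 'a l2 \<Rightarrow> 'a l2" is "\<lambda>u v x. u x + v x"
  by (auto intro: square_integrable_add)

lift_definition uminus_l2 :: "'a l2 \<Rightarrow> 'a l2" is "\<lambda>u x. - u x"
  using square_integrable_scale[of _ "-1"] by auto

lift_definition minus_l2 :: "'a l2 \<Rightarrow> 'a l2 \<Rightarrow> 'a l2" is "\<lambda>u v x. u x - v x"
  subgoal for u v u' v'
    using square_integrable_add[of u "\<lambda>x. - 1 * u' x"] square_integrable_add[of v "\<lambda>x. - 1 * v' x"]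
      square_integrable_scale[of u' "-1"] square_integrable_scale[of v' "-1"]
    by auto
  done

lift_definition scaleR_l2 :: "real \<Rightarrow> 'a l2 \<Rightarrow> 'a l2" is "\<lambda>c u x. c * u x"
  by (auto intro: square_integrable_scale)

lift_definition inner_l2 :: "'a l2 \<Rightarrow> 'a l2 \<Rightarrow> real" is "\<lambda>u v. LINT x|mu. u x * v x"
proof -
  fix u u' v v' :: "'a \<Rightarrow> real"
  assume A: "square_integrable u \<and> square_integrable u' \<and> (AE x in mu. u x = u' x)"
    "square_integrable v \<and> square_integrable v' \<and> (AE x in mu. v x = v' x)"
  then have "AE x in mu. u x * v x = u' x * v' x" by auto
  then show "(LINT x|mu. u x * v x) = (LINT x|mu. u' x * v' x)"
    using A by (intro integral_cong_AE) (auto simp: square_integrable_def)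
qed

definition norm_l2 :: "'a l2 \<Rightarrow> real" where "norm_l2 f = sqrt (inner f f)"

definition sgn_l2 :: "'a l2 \<Rightarrow> 'a l2" where "sgn_l2 f = inverse (norm f) *\<^sub>R f"

definition dist_l2 :: "'a l2 \<Rightarrow> 'a l2 \<Rightarrow> real" where "dist_l2 f g = norm (f - g)"

definition uniformity_l2 :: "('a l2 \<times> 'a l2) filter" where
  "uniformity_l2 = (INF e\<in>{0<..}. principal {(f, g). dist f g < e})"

definition open_l2 :: "'a l2 set \<Rightarrow> bool" where
  "open_l2 S \<longleftrightarrow> (\<forall>f\<in>S. \<forall>\<^sub>F (f', g) in uniformity. f' = f \<longrightarrow> g \<in> S)"

instance
proof
  fix f g h :: "'a l2" and a b :: real
  show "f + g + h = f + (g + h)"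
    by transfer (auto intro!: square_integrable_add simp: add.assoc)
  show "f + g = g + f"
    by transfer (auto intro!: square_integrable_add simp: add.commute)
  show "0 + f = f"
    by transfer auto
  show "- f + f = 0"
    by transfer (auto simp: square_integrable_zero)
  show "f - g = f + - g"
    by transfer (use square_integrable_add square_integrable_scale[of _ "-1"] in fastforce)
  show "a *\<^sub>R (f + g) = a *\<^sub>R f + a *\<^sub>R g"
    by transfer (auto intro!: square_integrable_add square_integrable_scale
        simp: distrib_left)
  show "(a + b) *\<^sub>R f = a *\<^sub>R f + b *\<^sub>R f"
    by transfer (auto intro!: square_integrable_add square_integrable_scale
        simp: distrib_right)
  show "a *\<^sub>R b *\<^sub>R f = (a * b) *\<^sub>R f"
    by transfer (auto intro!: square_integrable_scale simp: mult.assoc)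
  show "1 *\<^sub>R f = f"
    by transfer auto
  show "dist f g = norm (f - g)" by (rule dist_l2_def)
  show "sgn f = inverse (norm f) *\<^sub>R f" by (rule sgn_l2_def)
  show "norm f = sqrt (inner f f)" by (rule norm_l2_def)
  show "uniformity = (INF e\<in>{0<..}. principal {(f :: 'a l2, g). dist f g < e})"
    by (rule uniformity_l2_def)
  show "open S \<longleftrightarrow> (\<forall>f\<in>S. \<forall>\<^sub>F (f', g) in uniformity. f' = f \<longrightarrow> g \<in> S)" for S :: "'a l2 set"
    by (rule open_l2_def)
  show "inner f g = inner g f"
    by transfer (simp add: mult.commute)
  show "inner (f + g) h = inner f h + inner g h"
    by transfer (simp add: distrib_right square_integrable_mult)
  show "inner (a *\<^sub>R f) g = a * inner f g"
    by transfer (simp add: mult.assoc)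
  show "0 \<le> inner f f"
    by transfer simp
  show "inner f f = 0 \<longleftrightarrow> f = 0"
  proof transfer
    fix u :: "'a \<Rightarrow> real"
    assume u: "square_integrable u \<and> square_integrable u \<and> (AE x in mu. u x = u x)"
    have "(LINT x|mu. u x * u x) = 0 \<longleftrightarrow> (AE x in mu. u x * u x = 0)"
      using u by (intro integral_nonneg_eq_0_iff_AE) (auto simp: square_integrable_mult)
    then show "(LINT x|mu. u x * u x) = 0 \<longleftrightarrow>
        square_integrable u \<and> square_integrable (\<lambda>x. 0) \<and> (AE x in mu. u x = 0)"
      using u by (simp add: square_integrable_zero)
  qed
qed

end

text \<open>\<open>cls u\<close> is the class of \<open>u\<close> (meaningful for square integrable \<open>u\<close> only); \<open>fn f\<close> is a
  representative of \<open>f\<close>.\<close>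

definition cls :: "('a::metric_measure_space \<Rightarrow> real) \<Rightarrow> 'a l2" where
  "cls = abs_l2"

definition fn :: "'a::metric_measure_space l2 \<Rightarrow> 'a \<Rightarrow> real" where
  "fn = rep_l2"

lemma square_integrable_fn: "square_integrable (fn f)"
  using Quotient3_rep_reflp[OF Quotient3_l2] by (auto simp: fn_def)

lemma cls_fn: "cls (fn f) = f"
  by (simp add: cls_def fn_def Quotient3_abs_rep[OF Quotient3_l2])

lemma fn_cls: "square_integrable u \<Longrightarrow> AE x in mu. fn (cls u) x = u x"
  using Quotient3_rep_abs[OF Quotient3_l2, of u] by (auto simp: cls_def fn_def)

lemma inner_l2_fn: "inner f g = (LINT x|mu. fn f x * fn g x)"
  by (simp add: fn_def inner_l2.rep_eq)

definition radon_measure :: "'a::topological_space measure \<Rightarrow> bool" where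
  "radon_measure M \<longleftrightarrow> sets M = sets borel \<and>
     (\<forall>K. compact K \<longrightarrow> emeasure M K < \<infinity>) \<and>
     (\<forall>A\<in>sets borel. emeasure M A = (INF U\<in>{U. open U \<and> A \<subseteq> U}. emeasure M U)) \<and>
     (\<forall>U. open U \<longrightarrow> emeasure M U = (SUP K\<in>{K. compact K \<and> K \<subseteq> U}. emeasure M K))"

definition doubling :: "real \<Rightarrow> 'a::metric_space measure \<Rightarrow> bool" where
  "doubling d M \<longleftrightarrow> (\<forall>x. \<forall>r>0. 0 < emeasure M (ball x (2 * r)) \<and>
     emeasure M (ball x (2 * r)) \<le> ennreal (2 powr d) * emeasure M (ball x r))"

text \<open>An unbounded operator is a domain \<open>D\<close> together with a function \<open>L\<close> whose values
  outside \<open>D\<close> are irrelevant.  The last conjunct says that the graphs of the adjoint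
  and of the operator coincide.\<close>

definition self_adjoint :: "'h::real_inner set \<Rightarrow> ('h \<Rightarrow> 'h) \<Rightarrow> bool" where
  "self_adjoint D L \<longleftrightarrow> subspace D \<and> closure D = UNIV \<and>
     (\<forall>f\<in>D. \<forall>g\<in>D. \<forall>a b. L (a *\<^sub>R f + b *\<^sub>R g) = a *\<^sub>R L f + b *\<^sub>R L g) \<and>
     (\<forall>g h. (\<forall>f\<in>D. inner (L f) g = inner f h) \<longleftrightarrow> g \<in> D \<and> h = L g)"

definition nonneg_operator :: "'h::real_inner set \<Rightarrow> ('h \<Rightarrow> 'h) \<Rightarrow> bool" where
  "nonneg_operator D L \<longleftrightarrow> (\<forall>f\<in>D. 0 \<le> inner (L f) f)"

definition projection_valued_measure :: "(real set \<Rightarrow> 'h \<Rightarrow> 'h::real_inner) \<Rightarrow> bool" where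
  "projection_valued_measure E \<longleftrightarrow>
     (\<forall>A\<in>sets borel. bounded_linear (E A) \<and> (\<forall>f g. inner (E A f) g = inner f (E A g))) \<and>
     (\<forall>A\<in>sets borel. \<forall>B\<in>sets borel. \<forall>f. E (A \<inter> B) f = E A (E B f)) \<and>
     (\<forall>f. E UNIV f = f) \<and>
     (\<forall>A::nat \<Rightarrow> real set. range A \<subseteq> sets borel \<and> disjoint_family A \<longrightarrow>
        (\<forall>f. (\<lambda>n. E (A n) f) sums E (\<Union>n. A n) f))"

definition spectral_measure :: "(real set \<Rightarrow> 'h \<Rightarrow> 'h::real_inner) \<Rightarrow> 'h \<Rightarrow> real measure" where
  "spectral_measure E f = measure_of UNIV (sets borel) (\<lambda>A. ennreal (inner (E A f) f))"

text \<open>Domain and values of \<open>\<integral> \<phi> dE\<close>.  The bilinear integral \<open>\<integral> \<phi> d\<langle>E f, g\<rangle>\<close> is written by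
  polarization; it is tested against \<open>g\<close> in the (dense) domain only, so that \<open>\<phi>\<close> is integrable
  for both scalar measures.\<close>

definition fcalc_dom :: "(real set \<Rightarrow> 'h \<Rightarrow> 'h::real_inner) \<Rightarrow> (real \<Rightarrow> real) \<Rightarrow> 'h set" where
  "fcalc_dom E \<phi> = {f. integrable (spectral_measure E f) (\<lambda>t. (\<phi> t)\<^sup>2)}"

definition fcalc :: "(real set \<Rightarrow> 'h \<Rightarrow> 'h::real_inner) \<Rightarrow> (real \<Rightarrow> real) \<Rightarrow> 'h \<Rightarrow> 'h" where
  "fcalc E \<phi> f = (THE h. \<forall>g\<in>fcalc_dom E \<phi>. inner h g =
     ((LINT t|spectral_measure E (f + g). \<phi> t) - (LINT t|spectral_measure E (f - g). \<phi> t)) / 4)"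

definition spectral_resolution ::
  "'h::real_inner set \<Rightarrow> ('h \<Rightarrow> 'h) \<Rightarrow> (real set \<Rightarrow> 'h \<Rightarrow> 'h) \<Rightarrow> bool" where
  "spectral_resolution D L E \<longleftrightarrow> projection_valued_measure E \<and>
     D = fcalc_dom E (\<lambda>t. t) \<and> (\<forall>f\<in>D. L f = fcalc E (\<lambda>t. t) f)"

text \<open>\<open>half_power E k\<close> on \<open>half_power_dom E k\<close> is \<open>L\<^bsup>k/2\<^esup>\<close>, where \<open>E\<close> is the spectral resolution
  of \<open>L\<close>.  For a non-negative \<open>L\<close> the negative half line, where \<open>sqrt\<close> takes negative
  values, carries no spectral mass.\<close>

definition half_power_dom :: "(real set \<Rightarrow> 'h \<Rightarrow> 'h::real_inner) \<Rightarrow> nat \<Rightarrow> 'h set" where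
  "half_power_dom E k = fcalc_dom E (\<lambda>t. sqrt t ^ k)"

definition half_power :: "(real set \<Rightarrow> 'h \<Rightarrow> 'h::real_inner) \<Rightarrow> nat \<Rightarrow> 'h \<Rightarrow> 'h" where
  "half_power E k = fcalc E (\<lambda>t. sqrt t ^ k)"

definition PW :: "(real set \<Rightarrow> 'h \<Rightarrow> 'h::real_inner) \<Rightarrow> real \<Rightarrow> 'h set" where
  "PW E \<omega> = range (fcalc E (\<lambda>t. indicator {0..\<omega>} (sqrt t)))"

text \<open>The closed form of \<open>L\<close> has domain \<open>\<D>(L\<^bsup>1/2\<^esup>)\<close>; on \<open>\<D>(L)\<close> it equals \<open>\<langle>L f, g\<rangle>\<close>.\<close>

definition form_dom :: "(real set \<Rightarrow> 'h \<Rightarrow> 'h::real_inner) \<Rightarrow> 'h set" where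
  "form_dom E = half_power_dom E 1"

definition form :: "(real set \<Rightarrow> 'h \<Rightarrow> 'h::real_inner) \<Rightarrow> 'h \<Rightarrow> 'h \<Rightarrow> real" where
  "form E f g = inner (half_power E 1 f) (half_power E 1 g)"

text \<open>The form of a non-negative self-adjoint operator is automatically symmetric, densely
  defined and closed, so only the Markov property is left to require.\<close>

definition dirichlet_form ::
  "(real set \<Rightarrow> 'a l2 \<Rightarrow> 'a::metric_measure_space l2) \<Rightarrow> bool" where
  "dirichlet_form E \<longleftrightarrow> (\<forall>f\<in>form_dom E.
     let f' = cls (\<lambda>x. max 0 (min 1 (fn f x)))
     in f' \<in> form_dom E \<and> form E f' f' \<le> form E f f)"

definition Cc :: "('a::metric_space \<Rightarrow> real) set" where
  "Cc = {u. continuous_on UNIV u \<and> compact (closure {x. u x \<noteq> 0})}"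

definition form_core ::
  "(real set \<Rightarrow> 'a l2 \<Rightarrow> 'a::metric_measure_space l2) \<Rightarrow> ('a \<Rightarrow> real) set" where
  "form_core E = {u \<in> Cc. cls u \<in> form_dom E}"

definition regular_form ::
  "(real set \<Rightarrow> 'a l2 \<Rightarrow> 'a::metric_measure_space l2) \<Rightarrow> bool" where
  "regular_form E \<longleftrightarrow>
     (\<forall>f\<in>form_dom E. \<forall>\<epsilon>>0. \<exists>u\<in>form_core E.
        form E (f - cls u) (f - cls u) + (norm (f - cls u))\<^sup>2 < \<epsilon>) \<and>
     (\<forall>v\<in>Cc. \<forall>\<epsilon>>0. \<exists>u\<in>form_core E. \<forall>x. \<bar>v x - u x\<bar> < \<epsilon>)"

definition supp :: "'a::metric_measure_space l2 \<Rightarrow> 'a set" where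
  "supp f = - \<Union>{U. open U \<and> (AE x in mu. x \<in> U \<longrightarrow> fn f x = 0)}"

definition strongly_local ::
  "(real set \<Rightarrow> 'a l2 \<Rightarrow> 'a::metric_measure_space l2) \<Rightarrow> bool" where
  "strongly_local E \<longleftrightarrow> (\<forall>f\<in>form_dom E. \<forall>g\<in>form_dom E.
     compact (supp f) \<and> compact (supp g) \<and>
     (\<exists>U c. open U \<and> supp f \<subseteq> U \<and> (AE x in mu. x \<in> U \<longrightarrow> fn g x = c))
     \<longrightarrow> form E f g = 0)"

text \<open>\<open>\<Gamma> f\<close> is the positive measure \<open>d\<Gamma>(f,f)\<close>; the signed measures \<open>d\<Gamma>(f,g)\<close> arise from it by
  polarization.  For bounded \<open>f\<close> it is the measure representing the functional
  \<open>u \<mapsto> \<E>(uf,f) - \<E>(u,f\<^sup>2)/2\<close> on the core, and for general \<open>f\<close> it is the limit along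
  truncations.  Together with regularity these two clauses determine \<open>\<Gamma> f\<close> for \<open>f\<close> in the form
  domain; the total mass \<open>\<E>(f,f)\<close> reflects strong locality.\<close>

definition energy_measure ::
  "(real set \<Rightarrow> 'a l2 \<Rightarrow> 'a::metric_measure_space l2) \<Rightarrow> ('a l2 \<Rightarrow> 'a measure) \<Rightarrow> bool" where
  "energy_measure E \<Gamma> \<longleftrightarrow> (\<forall>f\<in>form_dom E.
     sets (\<Gamma> f) = sets borel \<and>
     emeasure (\<Gamma> f) UNIV = ennreal (form E f f) \<and>
     ((\<exists>c. AE x in mu. \<bar>fn f x\<bar> \<le> c) \<longrightarrow> (\<forall>u\<in>form_core E.
        (LINT x|\<Gamma> f. u x) =
          form E (cls (\<lambda>x. u x * fn f x)) f - form E (cls u) (cls (\<lambda>x. (fn f x)\<^sup>2)) / 2)) \<and>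
     (\<forall>A\<in>sets borel.
        (\<lambda>n::nat. emeasure (\<Gamma> (cls (\<lambda>x. max (- real n) (min (real n) (fn f x))))) A)
          \<longlonglongrightarrow> emeasure (\<Gamma> f) A))"

definition ball_mean :: "'a::metric_measure_space l2 \<Rightarrow> 'a set \<Rightarrow> real" where
  "ball_mean f B = (LINT x:B|mu. fn f x) / measure mu B"

definition local_poincare ::
  "'a::metric_measure_space l2 set \<Rightarrow> ('a l2 \<Rightarrow> 'a measure) \<Rightarrow> real \<Rightarrow> real \<Rightarrow> bool" where
  "local_poincare D \<Gamma> C r0 \<longleftrightarrow> (\<forall>f\<in>D. \<forall>x r. 0 < r \<and> r \<le> r0 \<longrightarrow>
     (LINT y:ball x r|mu. (fn f y - ball_mean f (ball x r))\<^sup>2)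
       \<le> C * r\<^sup>2 * measure (\<Gamma> f) (ball x r))"

text \<open>A lattice is given by its set of points, which also serves as the index set: disjointness of
  the (nonempty) half-radius balls makes an indexed family of centres injective.\<close>

definition rho_lattice :: "nat \<Rightarrow> real \<Rightarrow> 'a::metric_space set \<Rightarrow> bool" where
  "rho_lattice N \<rho> \<Lambda> \<longleftrightarrow> disjoint_family_on (\<lambda>y. ball y (\<rho> / 2)) \<Lambda> \<and>
     (\<Union>y\<in>\<Lambda>. ball y \<rho>) = UNIV \<and>
     (\<forall>x. finite {y\<in>\<Lambda>. x \<in> ball y \<rho>} \<and> card {y\<in>\<Lambda>. x \<in> ball y \<rho>} \<le> N)"

definition \<xi> :: "real \<Rightarrow> 'a::metric_measure_space \<Rightarrow> 'a l2" where
  "\<xi> \<rho> y = cls (\<lambda>x. measure mu (ball y \<rho>) powr (- 1 / 2) * indicator (ball y \<rho>) x)"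

definition samples ::
  "real \<Rightarrow> 'a set \<Rightarrow> 'a::metric_measure_space l2 \<Rightarrow> 'a \<Rightarrow> real" where
  "samples \<rho> \<Lambda> f = (\<lambda>y\<in>\<Lambda>. inner f (\<xi> \<rho> y))"

definition l2_seq :: "'a set \<Rightarrow> ('a \<Rightarrow> real) set" where
  "l2_seq \<Lambda> = {c \<in> extensional \<Lambda>. (\<lambda>y. (c y)\<^sup>2) summable_on \<Lambda>}"

text \<open>The threshold for \<open>\<rho>\<close> is allowed to depend on \<open>k\<close>, which makes the hypothesis weaker than
  a uniform threshold would.\<close>

definition sampling_surjective ::
  "(real set \<Rightarrow> 'a l2 \<Rightarrow> 'a::metric_measure_space l2) \<Rightarrow> nat \<Rightarrow> nat \<Rightarrow> bool" where
  "sampling_surjective E N k0 \<longleftrightarrow> (\<forall>k>k0. \<exists>\<rho>1>0. \<forall>\<rho> \<Lambda>.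
     0 < \<rho> \<and> \<rho> < \<rho>1 \<and> rho_lattice N \<rho> \<Lambda> \<longrightarrow>
     samples \<rho> \<Lambda> ` half_power_dom E k = l2_seq \<Lambda>)"

definition spline ::
  "(real set \<Rightarrow> 'a l2 \<Rightarrow> 'a::metric_measure_space l2) \<Rightarrow> real \<Rightarrow> 'a set \<Rightarrow> nat \<Rightarrow> 'a l2 \<Rightarrow> 'a l2"
  where
  "spline E \<rho> \<Lambda> k f = (THE s.
     s \<in> half_power_dom E k \<and> (\<forall>y\<in>\<Lambda>. inner s (\<xi> \<rho> y) = inner f (\<xi> \<rho> y)) \<and>
     (\<forall>u\<in>half_power_dom E k. (\<forall>y\<in>\<Lambda>. inner u (\<xi> \<rho> y) = inner f (\<xi> \<rho> y)) \<longrightarrow>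
        norm (half_power E k s) \<le> norm (half_power E k u)))"

text \<open>\<open>C\<^sub>1 = 2\<^bsup>1/k\<^esup> C\<^sub>0\<^bsup>1/2\<^esup>\<close> with \<open>C\<^sub>0 = C N\<close>; note the dependence on \<open>k\<close>.\<close>

definition C1 :: "real \<Rightarrow> nat \<Rightarrow> nat \<Rightarrow> real" where
  "C1 C N k = 2 powr (1 / real k) * sqrt (C * real N)"

end

theory Submission
  imports Defs
begin

text \<open>Write \<open>a = \<rho> C\<^sub>0\<^bsup>1/2\<^esup>\<close>.  If all samples of \<open>u\<close> vanish, then \<open>u\<close> has mean zero on every ball
  of the lattice, and summing the Poincare inequality over the balls gives
  \<open>\<parallel>u\<parallel> \<le> a \<parallel>L\<^bsup>1/2\<^esup>u\<parallel>\<close>.  The exponent is raised on this single vector: integrating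
  Bernoulli's inequality \<open>(a\<^sup>2t)\<^bsup>k\<^esup> \<ge> 1 + k (a\<^sup>2t - 1)\<close> against the spectral measure of \<open>u\<close> yields
  \<open>\<parallel>u\<parallel> \<le> a\<^bsup>k\<^esup> \<parallel>L\<^bsup>k/2\<^esup>u\<parallel>\<close> for every \<open>k \<ge> 1\<close>, not only for powers of two.  This coercivity makes
  the spline exist and be unique, and applied to \<open>u = f - S\<^sub>k f\<close> with the minimality of the spline it
  gives \<open>\<parallel>f - S\<^sub>k f\<parallel> \<le> 2 a\<^bsup>k\<^esup> \<parallel>L\<^bsup>k/2\<^esup>f\<parallel> \<le> 2 (a\<omega>)\<^bsup>k\<^esup> \<parallel>f\<parallel>\<close>, and the factor \<open>2\<close> is the one hidden in
  \<open>C\<^sub>1\<^bsup>k\<^esup>\<close>.\<close>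

section \<open>Completeness of the space of square integrable functions\<close>

lemma space_mu [simp]: "space (mu :: 'a::metric_measure_space measure) = UNIV"
  using sets_eq_imp_space_eq[OF sets_mu] by simp

lemma norm_l2_sq: "(norm f)\<^sup>2 = (LINT x|mu. (fn f x)\<^sup>2)"
  by (simp add: norm_l2_def inner_l2_fn power2_eq_square integral_nonneg_AE)

lemma fn_measurable [measurable]: "fn f \<in> borel_measurable mu"
  using square_integrable_fn by (auto simp: square_integrable_def)

lemma integrable_fn_sq: "integrable mu (\<lambda>x. (fn f x)\<^sup>2)"
  using square_integrable_fn by (auto simp: square_integrable_def)

lemma nn_integral_fn_sq: "(\<integral>\<^sup>+x. ennreal ((fn f x)\<^sup>2) \<partial>mu) = ennreal ((norm f)\<^sup>2)"
  by (simp add: norm_l2_sq nn_integral_eq_integral integrable_fn_sq)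

lemma fn_diff: "AE x in mu. fn (f - g) x = fn f x - fn g x"
proof -
  have "square_integrable (\<lambda>x. fn f x - fn g x)"
    using square_integrable_add[OF square_integrable_fn[of f] square_integrable_scale[OF square_integrable_fn[of g], of "-1"]]
    by simp
  moreover have "f - g = cls (\<lambda>x. fn f x - fn g x)"
    unfolding cls_def fn_def minus_l2_def by simp
  ultimately show ?thesis using fn_cls by metis
qed

text \<open>Fatou's lemma along the tail of \<open>X\<close> bounds the distance from
  \<open>v\<close> to \<open>X n\<close> by the oscillation of that tail. Applied once with
  oscillation \<open>1\<close>, it makes \<open>v\<close> square integrable, so that
  \<open>cls v\<close> is meaningful; applied with small oscillation, it gives the
  convergence.\<close>

lemma l2_limit_of_AE_limit:
  fixes X :: "nat \<Rightarrow> 'a::metric_measure_space l2"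
  assumes X: "Cauchy X" and v [measurable]: "v \<in> borel_measurable mu"
    and lim: "AE x in mu. (\<lambda>n. fn (X n) x) \<longlonglongrightarrow> v x"
  shows "X \<longlonglongrightarrow> cls v"
proof -
  have fatou: "(\<integral>\<^sup>+x. ennreal ((v x - fn (X n) x)\<^sup>2) \<partial>mu) \<le> ennreal (e\<^sup>2)"
    if "\<And>m. m \<ge> M \<Longrightarrow> norm (X m - X n) \<le> e" for n M e
  proof -
    have "(\<integral>\<^sup>+x. ennreal ((v x - fn (X n) x)\<^sup>2) \<partial>mu)
      = (\<integral>\<^sup>+x. liminf (\<lambda>m. ennreal ((fn (X m) x - fn (X n) x)\<^sup>2)) \<partial>mu)"
    proof (rule nn_integral_cong_AE, use lim in eventually_elim)
      case (elim x)
      have "(\<lambda>m. ennreal ((fn (X m) x - fn (X n) x)\<^sup>2)) \<longlonglongrightarrow> ennreal ((v x - fn (X n) x)\<^sup>2)"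
        by (intro tendsto_intros elim)
      then show ?case by (metis lim_imp_Liminf sequentially_bot)
    qed
    also have "\<dots> \<le> liminf (\<lambda>m. \<integral>\<^sup>+x. ennreal ((fn (X m) x - fn (X n) x)\<^sup>2) \<partial>mu)"
      by (rule nn_integral_liminf) measurable
    also have "(\<lambda>m. \<integral>\<^sup>+x. ennreal ((fn (X m) x - fn (X n) x)\<^sup>2) \<partial>mu) = (\<lambda>m. ennreal ((norm (X m - X n))\<^sup>2))"
    proof
      fix m
      have "(\<integral>\<^sup>+x. ennreal ((fn (X m) x - fn (X n) x)\<^sup>2) \<partial>mu) = (\<integral>\<^sup>+x. ennreal ((fn (X m - X n) x)\<^sup>2) \<partial>mu)"
        by (rule nn_integral_cong_AE, use fn_diff[of "X m" "X n"] in eventually_elim) simp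
      then show "(\<integral>\<^sup>+x. ennreal ((fn (X m) x - fn (X n) x)\<^sup>2) \<partial>mu) = ennreal ((norm (X m - X n))\<^sup>2)"
        by (simp add: nn_integral_fn_sq)
    qed
    also have "liminf (\<lambda>m. ennreal ((norm (X m - X n))\<^sup>2)) \<le> ennreal (e\<^sup>2)"
    proof (rule Liminf_le)
      show "\<forall>\<^sub>F m in sequentially. ennreal ((norm (X m - X n))\<^sup>2) \<le> ennreal (e\<^sup>2)"
        using eventually_ge_at_top[of M]
        by eventually_elim (intro ennreal_leI power_mono that, auto)
    qed simp
    finally show ?thesis .
  qed
  have ev: "\<exists>M. \<forall>n\<ge>M. \<forall>m\<ge>M. norm (X m - X n) \<le> e" if "e > 0" for e
    using metric_CauchyD[OF X that] unfolding dist_norm by (meson less_imp_le)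
  have sqd: "square_integrable (\<lambda>x. v x - fn (X n) x)"
    if "\<And>m. m \<ge> M \<Longrightarrow> norm (X m - X n) \<le> e" for n M e
    unfolding square_integrable_def
  proof safe
    show "integrable mu (\<lambda>x. (v x - fn (X n) x)\<^sup>2)"
      by (rule integrableI_bounded)
        (use fatou[OF that] le_less_trans[OF _ ennreal_less_top] in auto)
  qed measurable
  have sqv: "square_integrable v"
  proof -
    obtain M where M: "\<forall>n\<ge>M. \<forall>m\<ge>M. norm (X m - X n) \<le> 1" using ev[of 1] by auto
    have "square_integrable (\<lambda>x. (v x - fn (X M) x) + fn (X M) x)"
      by (rule square_integrable_add[OF sqd square_integrable_fn]) (use M in auto)
    then show ?thesis by simp
  qed
  have le: "norm (cls v - X n) \<le> e"
    if h: "\<And>m. m \<ge> M \<Longrightarrow> norm (X m - X n) \<le> e" and "e > 0" for n M e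
  proof -
    have "ennreal ((norm (cls v - X n))\<^sup>2) = (\<integral>\<^sup>+x. ennreal ((fn (cls v - X n) x)\<^sup>2) \<partial>mu)"
      by (simp add: nn_integral_fn_sq)
    also have "\<dots> = (\<integral>\<^sup>+x. ennreal ((v x - fn (X n) x)\<^sup>2) \<partial>mu)"
      by (rule nn_integral_cong_AE, use fn_diff[of "cls v" "X n"] fn_cls[OF sqv] in eventually_elim) simp
    also have "\<dots> \<le> ennreal (e\<^sup>2)" by (rule fatou[OF h])
    finally have "(norm (cls v - X n))\<^sup>2 \<le> e\<^sup>2" by (simp add: ennreal_le_iff)
    then show ?thesis using \<open>e > 0\<close> by (simp add: power2_le_iff_abs_le)
  qed
  show ?thesis
  proof (rule metric_LIMSEQ_I)
    fix e :: real assume "e > 0"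
    then obtain M where M: "\<forall>n\<ge>M. \<forall>m\<ge>M. norm (X m - X n) \<le> e/2" using ev[of "e/2"] by auto
    have "dist (X n) (cls v) < e" if "n \<ge> M" for n
      using le[of M n "e/2"] M that \<open>e > 0\<close> by (auto simp: dist_norm norm_minus_commute)
    then show "\<exists>M. \<forall>n\<ge>M. dist (X n) (cls v) < e" by blast
  qed
qed

text \<open>The weights \<open>4\<^bsup>n\<^esup>\<close> in the proof leave the increments pointwise bounded by a multiple of
  \<open>2\<^bsup>-n\<^esup>\<close>.\<close>

lemma l2_rapidly_Cauchy_AE_convergent:
  fixes X :: "nat \<Rightarrow> 'a::metric_measure_space l2"
  assumes X: "\<And>n. norm (X (Suc n) - X n) \<le> (1/4)^n"
  shows "AE x in mu. convergent (\<lambda>n. fn (X n) x)"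
proof -
  define d where "d n = fn (X (Suc n) - X n)" for n
  have [measurable]: "d n \<in> borel_measurable mu" for n by (simp add: d_def)
  have "(\<integral>\<^sup>+x. (\<Sum>n. ennreal (4^n * (d n x)\<^sup>2)) \<partial>mu) = (\<Sum>n. \<integral>\<^sup>+x. ennreal (4^n * (d n x)\<^sup>2) \<partial>mu)"
    by (rule nn_integral_suminf) measurable
  \<comment> \<open>Since \<open>4^n * ((1/4)^n)\<^sup>2 = (1/4)^n\<close>, the weighted series
    still has a finite integral and is therefore finite almost everywhere.\<close>
  also have "\<dots> \<le> (\<Sum>n. ennreal ((1/4)^n))"
  proof (rule suminf_le)
    fix n
    have "(\<integral>\<^sup>+x. ennreal (4^n * (d n x)\<^sup>2) \<partial>mu) = ennreal (4^n) * ennreal ((norm (X (Suc n) - X n))\<^sup>2)"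
      by (simp add: ennreal_mult nn_integral_cmult d_def nn_integral_fn_sq)
    also have "\<dots> \<le> ennreal (4^n) * ennreal (((1/4)^n)\<^sup>2)"
      by (intro mult_left_mono ennreal_leI power_mono X) auto
    also have "\<dots> = ennreal ((1/4)^n)"
      by (simp add: ennreal_mult[symmetric] power2_eq_square power_one_over)
    finally show "(\<integral>\<^sup>+x. ennreal (4^n * (d n x)\<^sup>2) \<partial>mu) \<le> ennreal ((1/4)^n)" .
  qed auto
  also have "\<dots> < \<infinity>"
    by (subst suminf_ennreal2) (auto intro: summable_geometric)
  finally have "AE x in mu. (\<Sum>n. ennreal (4^n * (d n x)\<^sup>2)) \<noteq> \<infinity>"
    by (intro nn_integral_PInf_AE) auto
  moreover have "AE x in mu. \<forall>n. d n x = fn (X (Suc n)) x - fn (X n) x"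
    unfolding d_def AE_all_countable using fn_diff by blast
  ultimately show ?thesis
  proof eventually_elim
    case (elim x)
    define F where "F = (\<lambda>m. ennreal (4^m * (d m x)\<^sup>2))"
    define S where "S = enn2real (suminf F)"
    have "suminf F \<noteq> top" using elim(1) unfolding F_def infinity_ennreal_def .
    then have SF: "suminf F = ennreal S" by (simp add: S_def less_top)
    have bound: "norm (d n x) \<le> sqrt S * (1/2)^n" for n
    proof -
      \<comment> \<open>A single term of the nonnegative series is at most its sum, which yields the
        geometric bound on \<open>d n x\<close>.\<close>
      have "sum F {n} \<le> suminf F"
        by (rule sum_le_suminf) (auto intro: summableI)
      also note SF
      finally have "4^n * (d n x)\<^sup>2 \<le> S"
        by (simp add: F_def ennreal_le_iff S_def)
      moreover have "4^n * (d n x)\<^sup>2 = (2^n * d n x)\<^sup>2"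
        by (simp add: power_mult_distrib power2_eq_square flip: power_mult_distrib)
      ultimately have "\<bar>2^n * d n x\<bar> \<le> sqrt S"
        using real_sqrt_le_mono[of "(2^n * d n x)\<^sup>2" S] by (simp only: real_sqrt_abs)
      then show ?thesis
        by (simp add: abs_mult power_one_over field_simps)
    qed
    have "summable (\<lambda>n. d n x)"
      by (rule summable_comparison_test'[OF _ bound]) (intro summable_mult summable_geometric, simp)
    then have "convergent (\<lambda>n. \<Sum>i<n. d i x)"
      by (simp add: summable_iff_convergent)
    then have "convergent (\<lambda>n. fn (X n) x - fn (X 0) x)"
      using elim(2) sum_lessThan_telescope[of "\<lambda>n. fn (X n) x"] by simp
    then have "convergent (\<lambda>n. fn (X n) x - fn (X 0) x + fn (X 0) x)"
      by (intro convergent_add convergent_const)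
    then show ?case by simp
  qed
qed

text \<open>Riesz-Fischer. A Cauchy sequence in norm may fail to converge pointwise, so a
  subsequence with increments at most \<open>(1/4)^n\<close> is extracted; its almost everywhere
  limit is the norm limit of the subsequence and hence of the whole sequence.\<close>

instance l2 :: (metric_measure_space) complete_space
proof
  fix X :: "nat \<Rightarrow> 'a l2"
  assume X: "Cauchy X"
  have "\<exists>r :: nat \<Rightarrow> nat. \<forall>n. (\<forall>i\<ge>r n. \<forall>j\<ge>r n. norm (X i - X j) \<le> (1/4)^n) \<and> r n < r (Suc n)"
  proof (rule dependent_nat_choice)
    have ex: "\<exists>M. \<forall>i\<ge>M. \<forall>j\<ge>M. norm (X i - X j) \<le> (1/4)^n" for n
      using metric_CauchyD[OF X, of "(1/4)^n"] unfolding dist_norm by (auto intro: less_imp_le)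
    then show "\<exists>M. \<forall>i\<ge>M. \<forall>j\<ge>M. norm (X i - X j) \<le> (1/4)^0" .
    fix x n
    obtain M where "\<forall>i\<ge>M. \<forall>j\<ge>M. norm (X i - X j) \<le> (1/4)^Suc n" using ex by blast
    then show "\<exists>y. (\<forall>i\<ge>y. \<forall>j\<ge>y. norm (X i - X j) \<le> (1/4)^Suc n) \<and> x < y"
      by (intro exI[of _ "max M (Suc x)"]) auto
  qed
  then obtain r where r: "\<And>n i j. i \<ge> r n \<Longrightarrow> j \<ge> r n \<Longrightarrow> norm (X i - X j) \<le> (1/4)^n"
    and mono: "\<And>n. r n < r (Suc n)" by blast
  have sm: "strict_mono r" using mono by (simp add: strict_mono_Suc_iff)
  define Y where "Y = X \<circ> r"
  have "norm (Y (Suc n) - Y n) \<le> (1/4)^n" for n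
    unfolding Y_def o_def by (rule r) (use mono[of n] in auto)
  from l2_rapidly_Cauchy_AE_convergent[OF this]
  have "AE x in mu. (\<lambda>n. fn (Y n) x) \<longlonglongrightarrow> lim (\<lambda>n. fn (Y n) x)"
    by eventually_elim (simp add: convergent_LIMSEQ_iff)
  \<comment> \<open>Where the values diverge, \<open>lim\<close> is an arbitrary constant; this
    happens on a null set only and keeps the function measurable.\<close>
  then have "Y \<longlonglongrightarrow> cls (\<lambda>x. lim (\<lambda>n. fn (Y n) x))"
    by (intro l2_limit_of_AE_limit) (auto simp: Y_def intro: Cauchy_subseq_Cauchy X sm)
  then show "convergent X"
    using Cauchy_converges_subseq[OF X sm] unfolding Y_def comp_def convergent_def by blast
qed

section \<open>Functional calculus of a projection valued measure\<close>

text \<open>A setwise comparison passes to simple functions term by term and then to the supremum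
  that defines the integral. It replaces linearity for spectral measures, which depend quadratically
  on the vector.\<close>

lemma nn_integral_measure_le:
  assumes sets: "sets N = sets M" "sets P = sets M"
    and le: "\<And>A. A \<in> sets M \<Longrightarrow> emeasure M A \<le> a * emeasure N A + b * emeasure P A"
  shows "(\<integral>\<^sup>+x. u x \<partial>M) \<le> a * (\<integral>\<^sup>+x. u x \<partial>N) + b * (\<integral>\<^sup>+x. u x \<partial>P)"
  unfolding nn_integral_def[of M]
proof (rule SUP_least)
  fix s assume "s \<in> {g. simple_function M g \<and> g \<le> u}"
  then have s: "simple_function M s" and su: "s \<le> u" by auto
  have space: "space N = space M" "space P = space M"
    using sets sets_eq_imp_space_eq by blast+
  have sN: "simple_function N s" and sP: "simple_function P s"
    using s simple_function_cong_algebra[OF sets(1) space(1)]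
      simple_function_cong_algebra[OF sets(2) space(2)] by auto
  have "integral\<^sup>S M s \<le> (\<Sum>x\<in>s ` space M. x * (a * emeasure N (s -` {x} \<inter> space M) + b * emeasure P (s -` {x} \<inter> space M)))"
    unfolding simple_integral_def
    by (intro sum_mono mult_left_mono le simple_functionD(2)[OF s]) auto
  also have "\<dots> = a * integral\<^sup>S N s + b * integral\<^sup>S P s"
    unfolding simple_integral_def space
    by (simp add: sum_distrib_left sum.distrib algebra_simps)
  also have "\<dots> = a * integral\<^sup>N N s + b * integral\<^sup>N P s"
    by (simp add: nn_integral_eq_simple_integral sN sP)
  also have "\<dots> \<le> a * (\<integral>\<^sup>+x. u x \<partial>N) + b * (\<integral>\<^sup>+x. u x \<partial>P)"
    using su by (intro add_mono mult_left_mono nn_integral_mono) (auto simp: le_fun_def)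
  finally show "integral\<^sup>S M s \<le> a * (\<integral>\<^sup>+x. u x \<partial>N) + b * (\<integral>\<^sup>+x. u x \<partial>P)" .
qed

text \<open>Completeness of \<open>'h\<close> provides the norm limits through which
  \<open>fcalc\<close> and the splines are obtained.\<close>

locale pvm =
  fixes E :: "real set \<Rightarrow> 'h \<Rightarrow> 'h::{real_inner,complete_space}"
  assumes pvm: "projection_valued_measure E"
begin

lemma bounded_linear_E: "A \<in> sets borel \<Longrightarrow> bounded_linear (E A)"
  using pvm by (simp add: projection_valued_measure_def)

lemma inner_E: "A \<in> sets borel \<Longrightarrow> inner (E A f) g = inner f (E A g)"
  using pvm by (simp add: projection_valued_measure_def)

lemma E_Int: "A \<in> sets borel \<Longrightarrow> B \<in> sets borel \<Longrightarrow> E A (E B f) = E (A \<inter> B) f"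
  using pvm by (simp add: projection_valued_measure_def)

lemma E_UNIV [simp]: "E UNIV f = f"
  using pvm by (simp add: projection_valued_measure_def)

lemma E_sums:
  assumes "range A \<subseteq> sets borel" "disjoint_family A"
  shows "(\<lambda>n::nat. E (A n) f) sums E (\<Union>n. A n) f"
  using pvm assms by (simp add: projection_valued_measure_def)

lemma inner_E_E:
  assumes "A \<in> sets borel" "B \<in> sets borel"
  shows "inner (E A f) (E B g) = inner (E (A \<inter> B) f) g"
proof -
  have "inner (E A f) (E B g) = inner f (E (A \<inter> B) g)"
    using assms by (simp add: inner_E E_Int)
  also have "\<dots> = inner (E (A \<inter> B) f) g" using assms by (simp add: inner_E)
  finally show ?thesis .
qed

lemma inner_E_self: "A \<in> sets borel \<Longrightarrow> inner (E A f) f = (norm (E A f))\<^sup>2"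
  using inner_E_E[of A A f f] by (simp add: power2_norm_eq_inner)

text \<open>Countable additivity for the constantly empty family: a series with constant terms
  converges only if the term is zero.\<close>

lemma E_empty [simp]: "E {} f = 0"
proof -
  have "(\<lambda>n::nat. E {} f) sums E (\<Union>n::nat. {}) f"
    by (rule E_sums) (auto simp: disjoint_family_on_def)
  then have "(\<lambda>n::nat. E {} f) \<longlonglongrightarrow> 0"
    by (intro summable_LIMSEQ_zero) (auto simp: sums_iff)
  then show ?thesis using LIMSEQ_const_iff by blast
qed

abbreviation "\<mu> \<equiv> spectral_measure E"

lemma sets_\<mu> [simp, measurable_cong]: "sets (\<mu> f) = sets borel"
  and space_\<mu> [simp]: "space (\<mu> f) = UNIV"
proof -
  have *: "sigma_sets UNIV (sets borel) = (sets borel :: real set set)"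
    using sets.sigma_sets_eq[of "borel :: real measure"] by simp
  show "sets (\<mu> f) = sets borel" "space (\<mu> f) = UNIV"
    by (auto simp: spectral_measure_def *)
qed

text \<open>\<open>measure_of\<close> returns the prescribed set function only if that is a measure.
  Pairing the strongly convergent sums of \<open>E\<close> with \<open>f\<close> gives countable
  additivity, and \<open>inner_E_self\<close> gives nonnegativity.\<close>

lemma emeasure_\<mu>:
  assumes "A \<in> sets borel"
  shows "emeasure (\<mu> f) A = ennreal ((norm (E A f))\<^sup>2)"
proof -
  have "emeasure (\<mu> f) A = ennreal (inner (E A f) f)"
  proof (rule emeasure_measure_of[OF spectral_measure_def])
    show "countably_additive (sets (\<mu> f)) (\<lambda>A. ennreal (inner (E A f) f))"
    proof (rule countably_additiveI)
      fix A :: "nat \<Rightarrow> real set"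
      assume A: "range A \<subseteq> sets (\<mu> f)" "disjoint_family A"
      then have "(\<lambda>n. inner (E (A n) f) f) sums inner (E (\<Union>n. A n) f) f"
        by (intro bounded_linear.sums[OF bounded_linear_inner_left] E_sums) auto
      moreover have "0 \<le> inner (E (A n) f) f" for n
        using A by (subst inner_E_self) auto
      ultimately show "(\<Sum>n. ennreal (inner (E (A n) f) f)) = ennreal (inner (E (\<Union>n. A n) f) f)"
        by (intro suminf_ennreal_eq)
    qed
  qed (use assms in \<open>auto simp: positive_def\<close>)
  then show ?thesis using assms by (simp add: inner_E_self)
qed

lemma measure_\<mu>: "A \<in> sets borel \<Longrightarrow> measure (\<mu> f) A = (norm (E A f))\<^sup>2"
  by (simp add: measure_def emeasure_\<mu>)

lemma finite_measure_\<mu>: "finite_measure (\<mu> f)"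
  by (rule finite_measureI) (simp add: emeasure_\<mu>)

lemma nn_integral_\<mu>_le:
  assumes "\<And>A. A \<in> sets borel \<Longrightarrow> (norm (E A h))\<^sup>2 \<le> a * (norm (E A f))\<^sup>2 + b * (norm (E A g))\<^sup>2"
    and "a \<ge> 0" "b \<ge> 0"
  shows "(\<integral>\<^sup>+x. u x \<partial>\<mu> h) \<le> ennreal a * (\<integral>\<^sup>+x. u x \<partial>\<mu> f) + ennreal b * (\<integral>\<^sup>+x. u x \<partial>\<mu> g)"
  using assms
  by (intro nn_integral_measure_le)
     (auto simp: emeasure_\<mu> simp flip: ennreal_mult ennreal_plus intro!: ennreal_leI)

lemma fcalc_dom_iff:
  assumes [measurable]: "\<phi> \<in> borel_measurable borel"
  shows "f \<in> fcalc_dom E \<phi> \<longleftrightarrow> (\<integral>\<^sup>+x. ennreal ((\<phi> x)\<^sup>2) \<partial>\<mu> f) < \<infinity>"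
  unfolding fcalc_dom_def by (simp add: integrable_iff_bounded)

text \<open>Closure under sums rests on the setwise bound of the spectral measure of
  \<open>f + g\<close> by twice the two others. The zero coefficients below only bring one-term
  bounds into the two-term shape of \<open>nn_integral_\<mu>_le\<close>.\<close>

lemma fcalc_dom_subspace:
  assumes [measurable]: "\<phi> \<in> borel_measurable borel"
  shows "subspace (fcalc_dom E \<phi>)"
proof (rule subspaceI)
  show "0 \<in> fcalc_dom E \<phi>"
  proof -
    have "(norm (E A 0))\<^sup>2 \<le> 0 * (norm (E A 0))\<^sup>2 + 0 * (norm (E A 0))\<^sup>2" if "A \<in> sets borel" for A
      using linear_simps(3)[OF bounded_linear_E[OF that]] by simp
    from nn_integral_\<mu>_le[OF this] show ?thesis
      by (simp add: fcalc_dom_iff)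
  qed
next
  fix f g assume "f \<in> fcalc_dom E \<phi>" "g \<in> fcalc_dom E \<phi>"
  then have fin: "(\<integral>\<^sup>+x. ennreal ((\<phi> x)\<^sup>2) \<partial>\<mu> f) < \<infinity>" "(\<integral>\<^sup>+x. ennreal ((\<phi> x)\<^sup>2) \<partial>\<mu> g) < \<infinity>"
    by (auto simp: fcalc_dom_iff)
  have "(norm (E A (f + g)))\<^sup>2 \<le> 2 * (norm (E A f))\<^sup>2 + 2 * (norm (E A g))\<^sup>2" if "A \<in> sets borel" for A
  proof -
    have "(norm (E A (f + g)))\<^sup>2 \<le> (norm (E A f) + norm (E A g))\<^sup>2"
      using linear_simps(1)[OF bounded_linear_E[OF that]] by (intro power_mono) (auto simp: norm_triangle_ineq)
    also have "\<dots> \<le> 2 * (norm (E A f))\<^sup>2 + 2 * (norm (E A g))\<^sup>2"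
      using sum_squares_bound[of "norm (E A f)" "norm (E A g)"] by (simp add: power2_sum)
    finally show ?thesis .
  qed
  from nn_integral_\<mu>_le[OF this, of "\<lambda>x. ennreal ((\<phi> x)\<^sup>2)"]
  have "(\<integral>\<^sup>+x. ennreal ((\<phi> x)\<^sup>2) \<partial>\<mu> (f + g)) \<le>
    ennreal 2 * (\<integral>\<^sup>+x. ennreal ((\<phi> x)\<^sup>2) \<partial>\<mu> f) + ennreal 2 * (\<integral>\<^sup>+x. ennreal ((\<phi> x)\<^sup>2) \<partial>\<mu> g)" by simp
  also have "\<dots> < \<infinity>" using fin by (simp add: ennreal_mult_less_top)
  finally show "f + g \<in> fcalc_dom E \<phi>" by (simp add: fcalc_dom_iff)
next
  fix c f assume "f \<in> fcalc_dom E \<phi>"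
  then have fin: "(\<integral>\<^sup>+x. ennreal ((\<phi> x)\<^sup>2) \<partial>\<mu> f) < \<infinity>" by (auto simp: fcalc_dom_iff)
  have "(norm (E A (c *\<^sub>R f)))\<^sup>2 \<le> c\<^sup>2 * (norm (E A f))\<^sup>2 + 0 * (norm (E A f))\<^sup>2" if "A \<in> sets borel" for A
    using linear_simps(5)[OF bounded_linear_E[OF that]] by (simp add: power_mult_distrib)
  from nn_integral_\<mu>_le[OF this, of "\<lambda>x. ennreal ((\<phi> x)\<^sup>2)"]
  have "(\<integral>\<^sup>+x. ennreal ((\<phi> x)\<^sup>2) \<partial>\<mu> (c *\<^sub>R f)) \<le> ennreal (c\<^sup>2) * (\<integral>\<^sup>+x. ennreal ((\<phi> x)\<^sup>2) \<partial>\<mu> f)" by simp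
  also have "\<dots> < \<infinity>" using fin by (simp add: ennreal_mult_less_top)
  finally show "c *\<^sub>R f \<in> fcalc_dom E \<phi>" by (simp add: fcalc_dom_iff)
qed

lemma AE_\<mu>_E:
  assumes "A \<in> sets borel"
  shows "AE x in \<mu> (E A f). x \<in> A"
proof (rule AE_I)
  show "emeasure (\<mu> (E A f)) (- A) = 0"
    using assms by (simp add: emeasure_\<mu> E_Int)
qed (use assms in auto)

text \<open>The spectral measure of \<open>E A f\<close> is finite and carried by \<open>A\<close>.
  This is the source of domain vectors: for density, for spectral truncation and for band-limited
  vectors.\<close>

lemma E_bounded_in_fcalc_dom:
  assumes [measurable]: "\<phi> \<in> borel_measurable borel" and A: "A \<in> sets borel"
    and bound: "\<And>x. x \<in> A \<Longrightarrow> \<bar>\<phi> x\<bar> \<le> c"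
  shows "E A f \<in> fcalc_dom E \<phi>"
proof -
  interpret finite_measure "\<mu> (E A f)" by (rule finite_measure_\<mu>)
  have "AE x in \<mu> (E A f). norm ((\<phi> x)\<^sup>2) \<le> c\<^sup>2"
    using AE_\<mu>_E[OF A, of f]
  proof eventually_elim
    case (elim x)
    then have "\<bar>\<phi> x\<bar>\<^sup>2 \<le> c\<^sup>2" by (intro power_mono bound) auto
    then show ?case by simp
  qed
  then show ?thesis
    unfolding fcalc_dom_def mem_Collect_eq by (rule integrable_const_bound) measurable
qed

text \<open>The line is cut into the level sets of the integer part of
  \<open>\<bar>\<phi> x\<bar>\<close>. On each of them \<open>\<phi>\<close> is bounded, so the
  component of \<open>w\<close> lies in the domain and is orthogonal to \<open>w\<close>, hence
  vanishes; the components sum to \<open>w\<close>. This density is what makes the description in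
  \<open>fcalc\<close> unique.\<close>

lemma eq_0_if_orthogonal_fcalc_dom:
  assumes [measurable]: "\<phi> \<in> borel_measurable borel"
    and orth: "\<And>g. g \<in> fcalc_dom E \<phi> \<Longrightarrow> inner w g = 0"
  shows "w = 0"
proof -
  define A where "A n = {x. nat \<lfloor>\<bar>\<phi> x\<bar>\<rfloor> = n}" for n
  have A [measurable]: "A n \<in> sets borel" for n
    unfolding A_def by measurable
  have "E (A n) w = 0" for n
  proof -
    have "E (A n) w \<in> fcalc_dom E \<phi>"
    proof (rule E_bounded_in_fcalc_dom)
      show "\<bar>\<phi> x\<bar> \<le> real n + 1" if "x \<in> A n" for x
        using that unfolding A_def mem_Collect_eq by linarith
    qed measurable
    then have "inner (E (A n) w) w = 0" using orth inner_commute by metis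
    then show ?thesis by (simp add: inner_E_self)
  qed
  moreover have "(\<lambda>n. E (A n) w) sums E (\<Union>n. A n) w"
    by (rule E_sums) (auto simp: A_def disjoint_family_on_def)
  moreover have "(\<Union>n. A n) = UNIV" by (auto simp: A_def)
  ultimately show ?thesis using sums_unique2[of "\<lambda>_. 0" 0 w] by auto
qed

text \<open>The operator integral of a simple function against \<open>E\<close>, as a sum over its
  level sets.\<close>

definition simple_op :: "(real \<Rightarrow> real) \<Rightarrow> 'h \<Rightarrow> 'h" where
  "simple_op s f = (\<Sum>c\<in>range s. c *\<^sub>R E (s -` {c}) f)"

lemma simple_functionD_borel:
  assumes "simple_function borel s"
  shows "finite (range s)" "s -` B \<in> sets borel"
  using simple_functionD[OF assms] by auto

lemma simple_op_linear:
  assumes "simple_function borel s"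
  shows "linear (simple_op s)"
proof -
  note E = bounded_linear_E[OF simple_functionD_borel(2)[OF assms]]
  show ?thesis
    by (rule linearI)
       (simp_all add: simple_op_def linear_simps(1)[OF E] linear_simps(5)[OF E] scaleR_add_right
         sum.distrib scaleR_sum_right mult.commute)
qed

lemma simple_function_expand:
  assumes "simple_function borel (s :: real \<Rightarrow> real)"
  shows "s x = (\<Sum>c\<in>range s. c * indicator (s -` {c}) x)"
  using simple_functionD_borel(1)[OF assms] by (simp add: indicator_def sum.delta' if_distrib cong: if_cong)

text \<open>Multiplicativity of \<open>E\<close> turns the double sum over level sets into the
  integral of the product. Allowing two functions makes distances between simple operators
  computable without additivity of \<open>simple_op\<close> in the function.\<close>

lemma inner_simple_op:
  assumes s: "simple_function borel s" and t: "simple_function borel t"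
  shows "inner (simple_op s f) (simple_op t f) = (LINT x|\<mu> f. s x * t x)"
proof -
  interpret finite_measure "\<mu> f" by (rule finite_measure_\<mu>)
  have *: "s x * t x = (\<Sum>c\<in>range s. \<Sum>d\<in>range t. c * d * indicator (s -` {c} \<inter> t -` {d}) x)" for x
    by (subst simple_function_expand[OF s], subst simple_function_expand[OF t])
       (simp add: sum_product indicator_inter_arith ac_simps)
  have m: "s -` {c} \<inter> t -` {d} \<in> sets borel" for c d
    using simple_functionD_borel(2) s t by blast
  have "(LINT x|\<mu> f. s x * t x) = (\<Sum>c\<in>range s. \<Sum>d\<in>range t. c * d * measure (\<mu> f) (s -` {c} \<inter> t -` {d}))"
    unfolding * using m
    by (simp add: Bochner_Integration.integral_sum less_top[symmetric])
  also have "\<dots> = (\<Sum>c\<in>range s. \<Sum>d\<in>range t. c * d * inner (E (s -` {c}) f) (E (t -` {d}) f))"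
    using m simple_functionD_borel(2)[OF s] simple_functionD_borel(2)[OF t]
    by (simp add: measure_\<mu> inner_E_E inner_E_self)
  also have "\<dots> = inner (simple_op s f) (simple_op t f)"
    unfolding simple_op_def inner_sum_left inner_sum_right
    by (subst sum.swap) (simp add: sum_distrib_left mult_ac)
  finally show ?thesis by simp
qed

text \<open>This is the polarized identity by which \<open>fcalc\<close> is defined, in the simple
  case from which the general one follows in the limit.\<close>

lemma inner_simple_op_polar:
  assumes s: "simple_function borel s"
  shows "inner (simple_op s f) g = ((LINT x|\<mu> (f + g). s x) - (LINT x|\<mu> (f - g). s x)) / 4"
proof -
  have m: "s -` {c} \<in> sets borel" for c
    using simple_functionD_borel(2) s by blast
  have int: "(LINT x|\<mu> h. s x) = (\<Sum>c\<in>range s. c * inner (E (s -` {c}) h) h)" for h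
  proof -
    interpret finite_measure "\<mu> h" by (rule finite_measure_\<mu>)
    have "(LINT x|\<mu> h. s x) = (LINT x|\<mu> h. (\<Sum>c\<in>range s. c * indicator (s -` {c}) x))"
      by (simp only: simple_function_expand[OF s, symmetric])
    also have "\<dots> = (\<Sum>c\<in>range s. c * measure (\<mu> h) (s -` {c}))"
      using m by (subst Bochner_Integration.integral_sum) (auto simp: less_top[symmetric])
    finally show ?thesis using m by (simp add: measure_\<mu> inner_E_self)
  qed
  have pol: "inner (E (s -` {c}) (f + g)) (f + g) - inner (E (s -` {c}) (f - g)) (f - g)
      = 4 * inner (E (s -` {c}) f) g" for c
  proof -
    have "inner (E (s -` {c}) g) f = inner (E (s -` {c}) f) g"
      using inner_E[OF m] inner_commute by metis
    then show ?thesis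
      by (simp add: linear_simps[OF bounded_linear_E[OF m]] inner_simps)
  qed
  show ?thesis
    unfolding int sum_subtractf[symmetric] right_diff_distrib[symmetric] pol
    by (simp add: simple_op_def inner_sum_left sum_divide_distrib)
qed

text \<open>The difference of two candidates for the description is orthogonal to the dense
  domain.\<close>

lemma fcalc_eqI:
  assumes [measurable]: "\<phi> \<in> borel_measurable borel"
    and h: "\<And>g. g \<in> fcalc_dom E \<phi> \<Longrightarrow>
      inner h g = ((LINT t|\<mu> (f + g). \<phi> t) - (LINT t|\<mu> (f - g). \<phi> t)) / 4"
  shows "fcalc E \<phi> f = h"
  unfolding fcalc_def
proof (rule the_equality)
  fix h' assume h': "\<forall>g\<in>fcalc_dom E \<phi>. inner h' g =
    ((LINT t|\<mu> (f + g). \<phi> t) - (LINT t|\<mu> (f - g). \<phi> t)) / 4"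
  have "h' - h = 0"
  proof (rule eq_0_if_orthogonal_fcalc_dom)
    fix g assume "g \<in> fcalc_dom E \<phi>"
    then show "inner (h' - h) g = 0" using h h' by (simp only: inner_diff_left)
  qed simp
  then show "h' = h" by simp
qed (use h in auto)

text \<open>By \<open>inner_simple_op\<close>, distances between the vectors
  \<open>simple_op (F n) f\<close> are distances of the functions \<open>F n\<close> in the space of
  square integrable functions over \<open>\<mu> f\<close>. Dominated convergence makes these small,
  completeness gives a limit, and the limit inherits the polarized identity. The factor
  \<open>2\<close> in the bound is that of the standard approximation by simple functions.\<close>

lemma fcalc_limit:
  assumes [measurable]: "\<phi> \<in> borel_measurable borel"
    and F [measurable]: "\<And>n. simple_function borel (F n)"
    and lim: "\<And>x. (\<lambda>n. F n x) \<longlonglongrightarrow> \<phi> x"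
    and bound: "\<And>n x. \<bar>F n x\<bar> \<le> 2 * \<bar>\<phi> x\<bar>"
    and f: "f \<in> fcalc_dom E \<phi>"
  shows "(\<lambda>n. simple_op (F n) f) \<longlonglongrightarrow> fcalc E \<phi> f"
    and "(norm (fcalc E \<phi> f))\<^sup>2 = (LINT x|\<mu> f. (\<phi> x)\<^sup>2)"
proof -
  have [measurable]: "F n \<in> borel_measurable borel" for n
    using F by (rule borel_measurable_simple_function)
  have int\<phi>: "integrable (\<mu> f) (\<lambda>x. (\<phi> x)\<^sup>2)" using f by (simp add: fcalc_dom_def)
  have prod_bound: "\<bar>F n x * F m x\<bar> \<le> 4 * (\<phi> x)\<^sup>2" for n m x
    using mult_mono[OF bound[of n x] bound[of m x]] by (simp add: abs_mult power2_eq_square)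
  have diff_bound: "(F n x - \<phi> x)\<^sup>2 \<le> 9 * (\<phi> x)\<^sup>2" for n x
  proof -
    have "\<bar>F n x - \<phi> x\<bar> \<le> 3 * \<bar>\<phi> x\<bar>" using bound[of n x] by linarith
    then have "\<bar>F n x - \<phi> x\<bar>\<^sup>2 \<le> (3 * \<bar>\<phi> x\<bar>)\<^sup>2" by (intro power_mono) auto
    then show ?thesis by (simp add: power_mult_distrib)
  qed
  have int_prod: "integrable (\<mu> f) (\<lambda>x. F n x * F m x)" for n m
    by (rule Bochner_Integration.integrable_bound[of _ "\<lambda>x. 4 * (\<phi> x)\<^sup>2"])
       (use int\<phi> prod_bound in auto)
  have int_diff: "integrable (\<mu> f) (\<lambda>x. (F n x - \<phi> x)\<^sup>2)" for n
    by (rule Bochner_Integration.integrable_bound[of _ "\<lambda>x. 9 * (\<phi> x)\<^sup>2"])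
       (use int\<phi> diff_bound in auto)
  define e where "e n = (LINT x|\<mu> f. (F n x - \<phi> x)\<^sup>2)" for n
  have "e \<longlonglongrightarrow> (LINT x|\<mu> f. 0)"
    unfolding e_def
  proof (rule integral_dominated_convergence[where w = "\<lambda>x. 9 * (\<phi> x)\<^sup>2"])
    have "(\<lambda>n. (F n x - \<phi> x)\<^sup>2) \<longlonglongrightarrow> (\<phi> x - \<phi> x)\<^sup>2" for x
      by (intro tendsto_intros lim)
    then show "AE x in \<mu> f. (\<lambda>n. (F n x - \<phi> x)\<^sup>2) \<longlonglongrightarrow> 0" by simp
  qed (use int\<phi> diff_bound in auto)
  then have e: "e \<longlonglongrightarrow> 0" by simp
  define T where "T n = simple_op (F n) f" for n
  have dist_T: "(norm (T n - T m))\<^sup>2 \<le> 2 * e n + 2 * e m" for n m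
  proof -
    have "(norm (T n - T m))\<^sup>2 = inner (T n) (T n) - 2 * inner (T n) (T m) + inner (T m) (T m)"
      by (simp add: power2_norm_eq_inner inner_diff_left inner_diff_right inner_commute)
    also have "\<dots> = (LINT x|\<mu> f. F n x * F n x - 2 * (F n x * F m x) + F m x * F m x)"
      using int_prod by (simp add: T_def inner_simple_op F)
    also have "\<dots> \<le> (LINT x|\<mu> f. 2 * (F n x - \<phi> x)\<^sup>2 + 2 * (F m x - \<phi> x)\<^sup>2)"
    proof (rule integral_mono)
      fix x
      \<comment> \<open>This square is exactly the right side minus the left side of the inequality
        to be shown.\<close>
      have "0 \<le> (F n x + F m x - 2 * \<phi> x)\<^sup>2" by simp
      then show "F n x * F n x - 2 * (F n x * F m x) + F m x * F m x
          \<le> 2 * (F n x - \<phi> x)\<^sup>2 + 2 * (F m x - \<phi> x)\<^sup>2"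
        by (simp add: power2_eq_square algebra_simps)
    qed (use int_prod int_diff in auto)
    also have "\<dots> = 2 * e n + 2 * e m"
      using int_diff by (simp add: e_def)
    finally show ?thesis .
  qed
  have "Cauchy T"
  proof (rule metric_CauchyI)
    fix \<epsilon> :: real assume "\<epsilon> > 0"
    then have "\<forall>\<^sub>F n in sequentially. e n < \<epsilon>\<^sup>2 / 4" by (intro order_tendstoD(2)[OF e]) simp
    then obtain M where M: "\<And>n. n \<ge> M \<Longrightarrow> e n < \<epsilon>\<^sup>2 / 4" by (auto simp: eventually_sequentially)
    have "dist (T m) (T n) < \<epsilon>" if "m \<ge> M" "n \<ge> M" for m n
    proof -
      have "(norm (T m - T n))\<^sup>2 < \<epsilon>\<^sup>2"
        using dist_T[of m n] M[OF that(1)] M[OF that(2)] by linarith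
      then show ?thesis using \<open>\<epsilon> > 0\<close> by (simp add: dist_norm power2_less_imp_less)
    qed
    then show "\<exists>M. \<forall>m\<ge>M. \<forall>n\<ge>M. dist (T m) (T n) < \<epsilon>" by blast
  qed
  then obtain h where h: "T \<longlonglongrightarrow> h" using Cauchy_convergent convergent_def by blast
  have lim_int: "(\<lambda>n. LINT x|\<mu> g. F n x) \<longlonglongrightarrow> (LINT x|\<mu> g. \<phi> x)" if "g \<in> fcalc_dom E \<phi>" for g
  \<comment> \<open>Only \<open>\<phi>\<close> squared is known to be integrable; as the spectral
    measure is finite, \<open>1 + (\<phi> x)\<^sup>2\<close> may dominate \<open>\<phi>\<close>
    itself.\<close>
  proof (rule integral_dominated_convergence[where w = "\<lambda>x. 2 * (1 + (\<phi> x)\<^sup>2)"])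
    interpret finite_measure "\<mu> g" by (rule finite_measure_\<mu>)
    show "integrable (\<mu> g) (\<lambda>x. 2 * (1 + (\<phi> x)\<^sup>2))" using that by (simp add: fcalc_dom_def)
    have "\<bar>\<phi> x\<bar> \<le> 1 + (\<phi> x)\<^sup>2" for x
      using sum_squares_bound[of 1 "\<bar>\<phi> x\<bar>"] by simp
    then have "\<bar>F n x\<bar> \<le> 2 * (1 + (\<phi> x)\<^sup>2)" for n x
      using bound[of n x] by (smt (verit))
    then show "AE x in \<mu> g. norm (F n x) \<le> 2 * (1 + (\<phi> x)\<^sup>2)" for n by simp
  qed (use lim in auto)
  have "fcalc E \<phi> f = h"
  proof (rule fcalc_eqI)
    fix g assume g: "g \<in> fcalc_dom E \<phi>"
    note S = fcalc_dom_subspace[OF assms(1)]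
    have "(\<lambda>n. inner (T n) g) \<longlonglongrightarrow> inner h g"
      by (intro tendsto_intros h)
    moreover have "(\<lambda>n. ((LINT x|\<mu> (f + g). F n x) - (LINT x|\<mu> (f - g). F n x)) / 4)
      \<longlonglongrightarrow> ((LINT x|\<mu> (f + g). \<phi> x) - (LINT x|\<mu> (f - g). \<phi> x)) / 4"
      by (intro tendsto_intros lim_int subspace_add[OF S] subspace_diff[OF S] f g) simp
    ultimately show "inner h g = ((LINT x|\<mu> (f + g). \<phi> x) - (LINT x|\<mu> (f - g). \<phi> x)) / 4"
      unfolding T_def inner_simple_op_polar[OF F] by (rule LIMSEQ_unique)
  qed simp
  then show "(\<lambda>n. simple_op (F n) f) \<longlonglongrightarrow> fcalc E \<phi> f" using h by (simp add: T_def[abs_def])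
  have "(\<lambda>n. (norm (T n))\<^sup>2) \<longlonglongrightarrow> (norm h)\<^sup>2" by (intro tendsto_intros h)
  moreover have "(\<lambda>n. LINT x|\<mu> f. F n x * F n x) \<longlonglongrightarrow> (LINT x|\<mu> f. (\<phi> x)\<^sup>2)"
  proof (rule integral_dominated_convergence[where w = "\<lambda>x. 4 * (\<phi> x)\<^sup>2"])
    show "AE x in \<mu> f. (\<lambda>n. F n x * F n x) \<longlonglongrightarrow> (\<phi> x)\<^sup>2"
      using lim by (auto intro!: tendsto_mult simp: power2_eq_square)
    show "AE x in \<mu> f. norm (F n x * F n x) \<le> 4 * (\<phi> x)\<^sup>2" for n
      using prod_bound[of n _ n] by (intro AE_I2) (simp only: real_norm_def)
  qed (use int\<phi> in auto)
  moreover have "(norm (T n))\<^sup>2 = (LINT x|\<mu> f. F n x * F n x)" for n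
    by (simp add: T_def inner_simple_op[OF F F, symmetric] power2_norm_eq_inner)
  ultimately have "(norm h)\<^sup>2 = (LINT x|\<mu> f. (\<phi> x)\<^sup>2)" using LIMSEQ_unique by auto
  then show "(norm (fcalc E \<phi> f))\<^sup>2 = (LINT x|\<mu> f. (\<phi> x)\<^sup>2)" using \<open>fcalc E \<phi> f = h\<close> by simp
qed

text \<open>The simple functions depend on \<open>\<phi>\<close> alone, so one sequence serves every
  vector of the domain; this lets linearity pass to the limit.\<close>

lemma fcalc_approx:
  assumes [measurable]: "\<phi> \<in> borel_measurable borel"
  obtains F where "\<And>n. linear (simple_op (F n))"
    and "\<And>f. f \<in> fcalc_dom E \<phi> \<Longrightarrow> (\<lambda>n. simple_op (F n) f) \<longlonglongrightarrow> fcalc E \<phi> f"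
    and "\<And>f. f \<in> fcalc_dom E \<phi> \<Longrightarrow> (norm (fcalc E \<phi> f))\<^sup>2 = (LINT x|\<mu> f. (\<phi> x)\<^sup>2)"
proof -
  obtain F where F: "\<And>n. simple_function borel (F n)" "\<And>x. (\<lambda>n. F n x) \<longlonglongrightarrow> \<phi> x"
    "\<And>n x. \<bar>F n x\<bar> \<le> 2 * \<bar>\<phi> x\<bar>"
    using borel_measurable_implies_sequence_metric[OF assms, of 0] by auto
  show thesis
    by (rule that[of F]) (use fcalc_limit[OF assms F] simple_op_linear F in auto)
qed

lemma norm_fcalc:
  assumes "\<phi> \<in> borel_measurable borel" "f \<in> fcalc_dom E \<phi>"
  shows "(norm (fcalc E \<phi> f))\<^sup>2 = (LINT x|\<mu> f. (\<phi> x)\<^sup>2)"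
  using fcalc_approx[OF assms(1)] assms(2) by metis

lemma nn_integral_fcalc:
  assumes "\<phi> \<in> borel_measurable borel" "f \<in> fcalc_dom E \<phi>"
  shows "(\<integral>\<^sup>+x. ennreal ((\<phi> x)\<^sup>2) \<partial>\<mu> f) = ennreal ((norm (fcalc E \<phi> f))\<^sup>2)"
  using assms by (simp add: norm_fcalc nn_integral_eq_integral fcalc_dom_def)

lemma fcalc_linear_combination:
  assumes \<phi>: "\<phi> \<in> borel_measurable borel" and f: "f \<in> fcalc_dom E \<phi>" and g: "g \<in> fcalc_dom E \<phi>"
  shows "fcalc E \<phi> (a *\<^sub>R f + b *\<^sub>R g) = a *\<^sub>R fcalc E \<phi> f + b *\<^sub>R fcalc E \<phi> g"
proof -
  obtain F where lin: "\<And>n. linear (simple_op (F n))"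
    and lim: "\<And>f. f \<in> fcalc_dom E \<phi> \<Longrightarrow> (\<lambda>n. simple_op (F n) f) \<longlonglongrightarrow> fcalc E \<phi> f"
    using fcalc_approx[OF \<phi>] by metis
  note S = fcalc_dom_subspace[OF \<phi>]
  have "(\<lambda>n. simple_op (F n) (a *\<^sub>R f + b *\<^sub>R g)) \<longlonglongrightarrow> fcalc E \<phi> (a *\<^sub>R f + b *\<^sub>R g)"
    by (intro lim subspace_add[OF S] subspace_scale[OF S] f g)
  moreover have "(\<lambda>n. simple_op (F n) (a *\<^sub>R f + b *\<^sub>R g)) \<longlonglongrightarrow> a *\<^sub>R fcalc E \<phi> f + b *\<^sub>R fcalc E \<phi> g"
    unfolding linear_add[OF lin] linear_scale[OF lin] by (intro tendsto_intros lim f g)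
  ultimately show ?thesis by (rule LIMSEQ_unique)
qed

text \<open>Each \<open>E A\<close> is bounded, so the spectral measures of \<open>u n\<close>
  converge on every set, and so do the integrals of a fixed simple function below the square of
  \<open>\<phi>\<close>. Their limits stay below \<open>c\<^sup>2\<close>, and so does the supremum.
  The varying bounds \<open>b n\<close> suit a minimizing sequence.\<close>

lemma fcalc_lower_semicontinuous:
  assumes [measurable]: "\<phi> \<in> borel_measurable borel"
    and u: "\<And>n. u n \<in> fcalc_dom E \<phi>" and lim: "u \<longlonglongrightarrow> f"
    and b: "\<And>n. norm (fcalc E \<phi> (u n)) \<le> b n" "b \<longlonglongrightarrow> c"
  shows "f \<in> fcalc_dom E \<phi> \<and> norm (fcalc E \<phi> f) \<le> c"
proof -
  have c: "c \<ge> 0"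
    using b norm_ge_zero by (meson LIMSEQ_le_const order_trans)
  have le: "(\<integral>\<^sup>+x. ennreal ((\<phi> x)\<^sup>2) \<partial>\<mu> f) \<le> ennreal (c\<^sup>2)"
    unfolding nn_integral_def
  proof (rule SUP_least)
    fix s assume "s \<in> {g. simple_function (\<mu> f) g \<and> g \<le> (\<lambda>x. ennreal ((\<phi> x)\<^sup>2))}"
    then have s: "simple_function (\<mu> f) s" and s_le: "\<And>x. s x \<le> ennreal ((\<phi> x)\<^sup>2)"
      by (auto simp: le_fun_def)
    have s': "simple_function (\<mu> g) s" for g
      using s by (metis simple_function_cong_algebra sets_\<mu> space_\<mu>)
    have m: "s -` {y} \<in> sets borel" for y using simple_functionD(2)[OF s, of "{y}"] by simp
    have "(\<lambda>n. integral\<^sup>S (\<mu> (u n)) s) \<longlonglongrightarrow> integral\<^sup>S (\<mu> f) s"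
      unfolding simple_integral_def space_\<mu>
    proof (intro tendsto_sum ennreal_tendsto_cmult)
      fix y assume "y \<in> range s"
      \<comment> \<open>Lying below a real square, the values of \<open>s\<close> are finite;
        multiplication by \<open>top\<close> would be discontinuous at zero.\<close>
      then show "y < top" using s_le le_less_trans ennreal_less_top by blast
      show "(\<lambda>n. emeasure (\<mu> (u n)) (s -` {y} \<inter> UNIV)) \<longlonglongrightarrow> emeasure (\<mu> f) (s -` {y} \<inter> UNIV)"
        using m by (simp add: emeasure_\<mu>)
          (intro tendsto_intros bounded_linear.tendsto[OF bounded_linear_E] lim)
    qed
    moreover have "(\<lambda>n. ennreal ((b n)\<^sup>2)) \<longlonglongrightarrow> ennreal (c\<^sup>2)"
      by (intro tendsto_intros b)
    moreover have "integral\<^sup>S (\<mu> (u n)) s \<le> ennreal ((b n)\<^sup>2)" for n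
    proof -
      have "integral\<^sup>S (\<mu> (u n)) s = integral\<^sup>N (\<mu> (u n)) s"
        by (simp add: nn_integral_eq_simple_integral s')
      also have "\<dots> \<le> (\<integral>\<^sup>+x. ennreal ((\<phi> x)\<^sup>2) \<partial>\<mu> (u n))"
        by (intro nn_integral_mono s_le)
      also have "\<dots> = ennreal ((norm (fcalc E \<phi> (u n)))\<^sup>2)"
        by (rule nn_integral_fcalc) (use u in auto)
      also have "\<dots> \<le> ennreal ((b n)\<^sup>2)"
        by (intro ennreal_leI power_mono b) auto
      finally show ?thesis .
    qed
    ultimately show "integral\<^sup>S (\<mu> f) s \<le> ennreal (c\<^sup>2)"
      by (intro LIMSEQ_le[of _ _ "\<lambda>n. ennreal ((b n)\<^sup>2)"]) auto
  qed
  then have f: "f \<in> fcalc_dom E \<phi>"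
    by (simp add: fcalc_dom_iff le_less_trans[OF _ ennreal_less_top])
  with le have "(norm (fcalc E \<phi> f))\<^sup>2 \<le> c\<^sup>2"
    by (simp add: nn_integral_fcalc ennreal_le_iff)
  with f c show ?thesis by (simp add: power2_le_iff_abs_le)
qed

text \<open>Identifies the operator in the definition of \<open>PW\<close> as a spectral projection,
  by polarizing the squared norm of \<open>E A f\<close>.\<close>

lemma fcalc_indicator:
  assumes [measurable]: "A \<in> sets borel"
  shows "fcalc E (indicator A) f = E A f"
proof (rule fcalc_eqI)
  fix g
  have "((norm (E A (f + g)))\<^sup>2 - (norm (E A (f - g)))\<^sup>2) / 4 = inner (E A f) (E A g)"
    by (simp add: linear_simps[OF bounded_linear_E[OF assms]] power2_norm_eq_inner inner_simps inner_commute)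
  also have "\<dots> = inner (E A f) g" using assms by (simp add: inner_E_E)
  finally show "inner (E A f) g = ((LINT t|\<mu> (f + g). indicator A t) - (LINT t|\<mu> (f - g). indicator A t)) / 4"
    by (simp add: measure_\<mu>)
qed measurable

text \<open>Projections of \<open>E\<close> commute and are contractions, so the spectral measure of
  \<open>E A f\<close> is setwise at most that of \<open>f\<close>.\<close>

lemma norm_fcalc_E_le:
  assumes [measurable]: "\<phi> \<in> borel_measurable borel" and A: "A \<in> sets borel"
    and f: "f \<in> fcalc_dom E \<phi>"
  shows "E A f \<in> fcalc_dom E \<phi> \<and> norm (fcalc E \<phi> (E A f)) \<le> norm (fcalc E \<phi> f)"
proof -
  have "(norm (E B (E A f)))\<^sup>2 \<le> 1 * (norm (E B f))\<^sup>2 + 0 * (norm (E B f))\<^sup>2" if B: "B \<in> sets borel" for B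
  proof -
    have comm: "E B (E A f) = E A (E B f)" using A B by (simp add: E_Int Int_commute)
    have "(norm (E A (E B f)))\<^sup>2 = inner (E A (E B f)) (E B f)" by (rule inner_E_self[OF A, symmetric])
    also have "\<dots> \<le> norm (E A (E B f)) * norm (E B f)" by (rule norm_cauchy_schwarz)
    finally have "norm (E A (E B f)) \<le> norm (E B f)"
      using mult_le_cancel_left_pos[of "norm (E A (E B f))"]
      by (cases "E A (E B f) = 0") (auto simp: power2_eq_square)
    then show ?thesis unfolding comm by (simp add: power_mono)
  qed
  from nn_integral_\<mu>_le[OF this, of "\<lambda>x. ennreal ((\<phi> x)\<^sup>2)"]
  have le: "(\<integral>\<^sup>+x. ennreal ((\<phi> x)\<^sup>2) \<partial>\<mu> (E A f)) \<le> (\<integral>\<^sup>+x. ennreal ((\<phi> x)\<^sup>2) \<partial>\<mu> f)" by simp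
  then have d: "E A f \<in> fcalc_dom E \<phi>"
    using f by (auto simp: fcalc_dom_iff intro: le_less_trans)
  have "(norm (fcalc E \<phi> (E A f)))\<^sup>2 \<le> (norm (fcalc E \<phi> f))\<^sup>2"
    using le f d by (simp add: nn_integral_fcalc ennreal_le_iff)
  with d show ?thesis by (auto intro: power2_le_imp_le)
qed

text \<open>The squared distance from \<open>f\<close> to \<open>E (A n) f\<close> is the spectral
  mass outside \<open>A n\<close>, which tends to zero by continuity from below.\<close>

lemma E_exhaustion:
  assumes A: "range A \<subseteq> sets borel" "incseq A" "(\<Union>n. A n) = UNIV"
  shows "(\<lambda>n::nat. E (A n) f) \<longlonglongrightarrow> f"
proof -
  interpret finite_measure "\<mu> f" by (rule finite_measure_\<mu>)
  have "(\<lambda>n. measure (\<mu> f) (A n)) \<longlonglongrightarrow> measure (\<mu> f) (\<Union>n. A n)"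
    by (rule finite_Lim_measure_incseq) (use A in auto)
  then have "(\<lambda>n. (norm f)\<^sup>2 - measure (\<mu> f) (A n)) \<longlonglongrightarrow> (norm f)\<^sup>2 - measure (\<mu> f) UNIV"
    unfolding A(3) by (intro tendsto_intros)
  moreover have "(norm f)\<^sup>2 - measure (\<mu> f) (A n) = (norm (E (A n) f - f))\<^sup>2" for n
  proof -
    have An: "A n \<in> sets borel" using A by auto
    have "(norm (E (A n) f - f))\<^sup>2 = inner (E (A n) f) (E (A n) f) - 2 * inner (E (A n) f) f + inner f f"
      by (simp add: power2_norm_eq_inner inner_diff_left inner_diff_right inner_commute)
    then show ?thesis using An by (simp add: measure_\<mu> inner_E_self power2_norm_eq_inner)
  qed
  ultimately have "(\<lambda>n. (norm (E (A n) f - f))\<^sup>2) \<longlonglongrightarrow> 0" by (simp add: measure_\<mu>)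
  then have "(\<lambda>n. sqrt ((norm (E (A n) f - f))\<^sup>2)) \<longlonglongrightarrow> sqrt 0" by (rule tendsto_real_sqrt)
  then show ?thesis by (simp add: tendsto_norm_zero_iff flip: LIM_zero_iff[of _ f])
qed

section \<open>Half powers and Paley-Wiener vectors\<close>

lemma half_power_fun_sq: "(sqrt t ^ k)\<^sup>2 = \<bar>t\<bar> ^ k"
  by (simp add: power_mult_distrib power2_eq_square flip: power_mult_distrib)

text \<open>The absolute value reflects that \<open>sqrt\<close> is extended to negative reals as an
  odd function.\<close>

lemma half_power_norm:
  assumes "f \<in> half_power_dom E k"
  shows "(norm (half_power E k f))\<^sup>2 = (LINT t|\<mu> f. \<bar>t\<bar> ^ k)"
  using norm_fcalc[of "\<lambda>t. sqrt t ^ k" f] assms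
  by (simp add: half_power_dom_def half_power_def half_power_fun_sq)

lemma half_power_dom_iff: "f \<in> half_power_dom E k \<longleftrightarrow> integrable (\<mu> f) (\<lambda>t. \<bar>t\<bar> ^ k)"
  by (simp add: half_power_dom_def fcalc_dom_def half_power_fun_sq)

lemma half_power_dom_mono:
  assumes "f \<in> half_power_dom E k" "j \<le> k"
  shows "f \<in> half_power_dom E j"
  unfolding half_power_dom_iff
proof (rule Bochner_Integration.integrable_bound[of _ "\<lambda>t. 1 + \<bar>t\<bar> ^ k"])
  interpret finite_measure "\<mu> f" by (rule finite_measure_\<mu>)
  show "integrable (\<mu> f) (\<lambda>t. 1 + \<bar>t\<bar> ^ k)"
    using assms by (simp add: half_power_dom_iff)
  have "\<bar>t\<bar> ^ j \<le> 1 + \<bar>t\<bar> ^ k" for t :: real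
  proof (cases "\<bar>t\<bar> \<le> 1")
    case True
    then show ?thesis using power_le_one[of "\<bar>t\<bar>" j] by (simp add: add_increasing2)
  next
    case False
    then show ?thesis using power_increasing[OF assms(2), of "\<bar>t\<bar>"] by linarith
  qed
  then show "AE t in \<mu> f. norm (\<bar>t\<bar> ^ j) \<le> norm (1 + \<bar>t\<bar> ^ k)" by simp
qed measurable

text \<open>A form of Jensen's inequality for one vector: the power is minorized by its tangent at
  \<open>1\<close>, and by \<open>le\<close> the linear term has nonnegative integral. Iterating
  \<open>le\<close> instead would require it for \<open>half_power E 1 u\<close>, about whose
  samples nothing is known.\<close>

lemma norm_le_half_power:
  assumes u: "u \<in> half_power_dom E k" and k: "k \<ge> 1" and a: "a \<ge> 0"
    and le: "norm u \<le> a * norm (half_power E 1 u)"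
  shows "norm u \<le> a ^ k * norm (half_power E k u)"
proof -
  interpret finite_measure "\<mu> u" by (rule finite_measure_\<mu>)
  have u1: "u \<in> half_power_dom E 1" by (rule half_power_dom_mono[OF u k])
  have int: "integrable (\<mu> u) (\<lambda>t. \<bar>t\<bar>)" "integrable (\<mu> u) (\<lambda>t. \<bar>t\<bar> ^ k)"
    using u u1 by (simp_all add: half_power_dom_iff)
  have total: "measure (\<mu> u) UNIV = (norm u)\<^sup>2" by (simp add: measure_\<mu>)
  have m1: "(norm u)\<^sup>2 \<le> a\<^sup>2 * (LINT t|\<mu> u. \<bar>t\<bar>)"
    using power_mono[OF le, of 2] half_power_norm[OF u1] by (simp add: power_mult_distrib)
  have "(norm u)\<^sup>2 + real k * (a\<^sup>2 * (LINT t|\<mu> u. \<bar>t\<bar>) - (norm u)\<^sup>2)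
      = (LINT t|\<mu> u. 1 + real k * (a\<^sup>2 * \<bar>t\<bar> - 1))"
    using int by (simp add: total right_diff_distrib)
  also have "\<dots> \<le> (LINT t|\<mu> u. (a ^ k)\<^sup>2 * \<bar>t\<bar> ^ k)"
  proof (rule integral_mono)
    fix t :: real
    \<comment> \<open>Bernoulli's inequality requires an increment of at least \<open>-1\<close>,
      which here means that \<open>a\<^sup>2 * \<bar>t\<bar>\<close> is nonnegative.\<close>
    have "1 + real k * (a\<^sup>2 * \<bar>t\<bar> - 1) \<le> (1 + (a\<^sup>2 * \<bar>t\<bar> - 1)) ^ k"
      by (rule Bernoulli_inequality) simp
    then show "1 + real k * (a\<^sup>2 * \<bar>t\<bar> - 1) \<le> (a ^ k)\<^sup>2 * \<bar>t\<bar> ^ k"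
      by (simp add: power_mult_distrib power_even_eq power_mult[symmetric] mult.commute)
  qed (use int in auto)
  also have "\<dots> = (a ^ k * norm (half_power E k u))\<^sup>2"
    by (simp add: half_power_norm[OF u] power_mult_distrib)
  finally have "(norm u)\<^sup>2 + real k * (a\<^sup>2 * (LINT t|\<mu> u. \<bar>t\<bar>) - (norm u)\<^sup>2)
      \<le> (a ^ k * norm (half_power E k u))\<^sup>2" .
  moreover have "0 \<le> real k * (a\<^sup>2 * (LINT t|\<mu> u. \<bar>t\<bar>) - (norm u)\<^sup>2)" using m1 by simp
  ultimately have "(norm u)\<^sup>2 \<le> (a ^ k * norm (half_power E k u))\<^sup>2" by linarith
  then show ?thesis by (rule power2_le_imp_le) (use a in simp)
qed

text \<open>Such an \<open>f\<close> is of the form \<open>E S g\<close>, so its spectral measure is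
  carried by \<open>S\<close>, where the integrand is at most \<open>\<omega> ^ k\<close>.\<close>

lemma PW_half_power:
  assumes f: "f \<in> PW E \<omega>"
  shows "f \<in> half_power_dom E k" "norm (half_power E k f) \<le> \<omega> ^ k * norm f"
proof -
  define S where "S = {t::real. 0 \<le> sqrt t \<and> sqrt t \<le> \<omega>}"
  have S [measurable]: "S \<in> sets borel" unfolding S_def by measurable
  have "(\<lambda>t. indicator {0..\<omega>} (sqrt t)) = (indicator S :: real \<Rightarrow> real)"
    by (auto simp: S_def indicator_def)
  then obtain g where g: "f = E S g" using f fcalc_indicator[OF S] by (auto simp: PW_def)
  have bound: "\<bar>sqrt t ^ k\<bar> \<le> \<omega> ^ k" if "t \<in> S" for t
    using that by (auto simp: S_def intro!: power_mono)
  show dom: "f \<in> half_power_dom E k"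
    unfolding g half_power_dom_def by (rule E_bounded_in_fcalc_dom[OF _ S bound]) simp_all
  interpret finite_measure "\<mu> f" by (rule finite_measure_\<mu>)
  have "(norm (half_power E k f))\<^sup>2 \<le> (LINT t|\<mu> f. (\<omega> ^ k)\<^sup>2)"
    unfolding half_power_norm[OF dom]
  proof (rule integral_mono_AE)
    show "AE t in \<mu> f. \<bar>t\<bar> ^ k \<le> (\<omega> ^ k)\<^sup>2"
      using AE_\<mu>_E[OF S, of g] unfolding g[symmetric]
    proof eventually_elim
      case (elim t)
      then have "\<bar>sqrt t ^ k\<bar>\<^sup>2 \<le> (\<omega> ^ k)\<^sup>2" by (intro power_mono bound) auto
      then show ?case by (simp add: half_power_fun_sq)
    qed
  qed (use dom in \<open>simp_all add: half_power_dom_iff\<close>)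
  also have "\<dots> = (\<omega> ^ k * norm f)\<^sup>2" by (simp add: measure_\<mu> power_mult_distrib)
  finally have le: "(norm (half_power E k f))\<^sup>2 \<le> (\<omega> ^ k * norm f)\<^sup>2" .
  \<comment> \<open>The sign of \<omega> is left open: for negative \<omega> the set
    \<open>S\<close> is empty and \<open>f\<close> is zero.\<close>
  have "0 \<le> \<omega> ^ k * norm f"
  proof (cases "\<omega> \<ge> 0")
    case False
    then have "S = {}" unfolding S_def by (auto dest: order_trans[OF real_sqrt_ge_zero])
    then show ?thesis using g by simp
  qed simp
  with le show "norm (half_power E k f) \<le> \<omega> ^ k * norm f" by (rule power2_le_imp_le)
qed

section \<open>Splines\<close>

text \<open>The projection argument for a closed operator. The parallelogram law makes the images of
  a minimizing sequence Cauchy; differences of admissible vectors satisfy the homogeneous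
  constraints, so coercivity makes the sequence itself Cauchy; lower semicontinuity puts its limit
  in the domain. The vector \<open>f\<close> shows that the constraints can be met.\<close>

lemma ex1_constrained_minimizer:
  fixes e :: "'b \<Rightarrow> 'h"
  assumes \<phi>: "\<phi> \<in> borel_measurable borel" and f: "f \<in> fcalc_dom E \<phi>" and c: "c \<ge> 0"
    and coercive: "\<And>u. u \<in> fcalc_dom E \<phi> \<Longrightarrow> (\<And>y. y \<in> \<Lambda> \<Longrightarrow> inner u (e y) = 0) \<Longrightarrow>
      norm u \<le> c * norm (fcalc E \<phi> u)"
  shows "\<exists>!s. s \<in> fcalc_dom E \<phi> \<and> (\<forall>y\<in>\<Lambda>. inner s (e y) = inner f (e y)) \<and>
    (\<forall>u\<in>fcalc_dom E \<phi>. (\<forall>y\<in>\<Lambda>. inner u (e y) = inner f (e y)) \<longrightarrow>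
      norm (fcalc E \<phi> s) \<le> norm (fcalc E \<phi> u))"
proof -
  define V where "V = fcalc_dom E \<phi>"
  define T where "T = fcalc E \<phi>"
  define K where "K = {u\<in>V. \<forall>y\<in>\<Lambda>. inner u (e y) = inner f (e y)}"
  have V: "subspace V" unfolding V_def by (rule fcalc_dom_subspace[OF \<phi>])
  have lin: "T (a *\<^sub>R u + b *\<^sub>R v) = a *\<^sub>R T u + b *\<^sub>R T v" if "u \<in> V" "v \<in> V" for a b u v
    using that unfolding T_def V_def by (rule fcalc_linear_combination[OF \<phi>])
  have diffK: "norm (u - v) \<le> c * norm (T u - T v)" if "u \<in> K" "v \<in> K" for u v
  proof -
    have uv: "u \<in> V" "v \<in> V" using that by (auto simp: K_def)
    have "norm (u - v) \<le> c * norm (T (u - v))"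
      unfolding T_def by (rule coercive)
        (use that subspace_diff[OF V] in \<open>auto simp: K_def V_def inner_diff_left\<close>)
    also have "T (u - v) = T u - T v" using lin[OF uv, of 1 "-1"] by simp
    finally show ?thesis .
  qed
  define m where "m = (INF u\<in>K. norm (T u))"
  have fK: "f \<in> K" using f by (simp add: K_def V_def)
  have bdd: "bdd_below ((\<lambda>u. norm (T u)) ` K)" by (rule bdd_belowI2[of _ 0]) simp
  have m_le: "m \<le> norm (T u)" if "u \<in> K" for u
    unfolding m_def using bdd that by (rule cINF_lower)
  have m0: "m \<ge> 0" unfolding m_def using fK by (intro cINF_greatest) auto
  have par: "(norm (T u - T v))\<^sup>2 \<le> 2 * (norm (T u))\<^sup>2 + 2 * (norm (T v))\<^sup>2 - 4 * m\<^sup>2"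
    if "u \<in> K" "v \<in> K" for u v
  proof -
    have uv: "u \<in> V" "v \<in> V" using that by (auto simp: K_def)
    have "(1/2) *\<^sub>R u + (1/2) *\<^sub>R v \<in> V"
      by (intro subspace_add[OF V] subspace_scale[OF V] uv)
    moreover have "inner ((1/2) *\<^sub>R u + (1/2) *\<^sub>R v) (e y) = inner f (e y)" if "y \<in> \<Lambda>" for y
    proof -
      have "inner u (e y) = inner f (e y)" "inner v (e y) = inner f (e y)"
        using \<open>u \<in> K\<close> \<open>v \<in> K\<close> that by (auto simp: K_def)
      then show ?thesis by (simp add: inner_add_left)
    qed
    ultimately have "(1/2) *\<^sub>R u + (1/2) *\<^sub>R v \<in> K" by (simp add: K_def)
    \<comment> \<open>The midpoint of two admissible vectors is admissible, so its image is at least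
      as long as the infimum.\<close>
    then have "m \<le> norm ((1/2) *\<^sub>R T u + (1/2) *\<^sub>R T v)" using m_le lin[OF uv] by metis
    also have "\<dots> = norm (T u + T v) / 2"
      by (simp add: scaleR_right_distrib[symmetric])
    finally have "(2 * m)\<^sup>2 \<le> (norm (T u + T v))\<^sup>2" using m0 by (intro power_mono) auto
    moreover have "(norm (T u - T v))\<^sup>2 + (norm (T u + T v))\<^sup>2 = 2 * (norm (T u))\<^sup>2 + 2 * (norm (T v))\<^sup>2"
      by (simp add: power2_norm_eq_inner inner_simps inner_commute)
    ultimately show ?thesis by (simp add: power_mult_distrib)
  qed
  have "\<exists>u\<in>K. norm (T u) < m + 1 / (real n + 1)" for n
  proof -
    have "(INF u\<in>K. norm (T u)) < m + 1 / (real n + 1)" by (simp add: m_def)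
    then show ?thesis using fK bdd by (subst (asm) cINF_less_iff) auto
  qed
  then obtain u where uK: "\<And>n. u n \<in> K" and u: "\<And>n. norm (T (u n)) < m + 1 / (real n + 1)" by metis
  have lim: "(\<lambda>n. m + 1 / (real n + 1)) \<longlonglongrightarrow> m"
    using tendsto_add[OF tendsto_const[of m] LIMSEQ_inverse_real_of_nat] by (simp add: field_simps)
  \<comment> \<open>The excess of the squared level over its infimum; through \<open>par\<close> it
    controls the distance between the images.\<close>
  define \<delta> where "\<delta> n = (m + 1 / (real n + 1))\<^sup>2 - m\<^sup>2" for n
  have "\<delta> \<longlonglongrightarrow> m\<^sup>2 - m\<^sup>2" unfolding \<delta>_def by (intro tendsto_intros lim)
  then have \<delta>: "\<delta> \<longlonglongrightarrow> 0" by simp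
  have sq: "(norm (u i - u j))\<^sup>2 \<le> c\<^sup>2 * (2 * \<delta> i + 2 * \<delta> j)" for i j
  proof -
    have "(norm (T (u n)))\<^sup>2 \<le> \<delta> n + m\<^sup>2" for n
      using power_mono[OF less_imp_le[OF u[of n]], of 2] by (simp add: \<delta>_def)
    from this[of i] this[of j] par[OF uK uK, of i j]
    have "(norm (T (u i) - T (u j)))\<^sup>2 \<le> 2 * \<delta> i + 2 * \<delta> j" by linarith
    moreover have "(norm (u i - u j))\<^sup>2 \<le> c\<^sup>2 * (norm (T (u i) - T (u j)))\<^sup>2"
      using power_mono[OF diffK[OF uK uK, of i j], of 2] by (simp add: power_mult_distrib)
    ultimately show ?thesis using mult_left_mono[of _ _ "c\<^sup>2"] by (meson order_trans zero_le_power2)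
  qed
  have "Cauchy u"
  proof (rule metric_CauchyI)
    fix \<epsilon> :: real assume "\<epsilon> > 0"
    have "(\<lambda>n. c\<^sup>2 * \<delta> n) \<longlonglongrightarrow> c\<^sup>2 * 0" by (intro tendsto_intros \<delta>)
    then have "\<forall>\<^sub>F n in sequentially. c\<^sup>2 * \<delta> n < \<epsilon>\<^sup>2 / 4"
      using \<open>\<epsilon> > 0\<close> by (intro order_tendstoD(2)) auto
    then obtain M where M: "\<And>n. n \<ge> M \<Longrightarrow> c\<^sup>2 * \<delta> n < \<epsilon>\<^sup>2 / 4" by (auto simp: eventually_sequentially)
    have "dist (u i) (u j) < \<epsilon>" if "i \<ge> M" "j \<ge> M" for i j
    proof -
      have "(norm (u i - u j))\<^sup>2 < \<epsilon>\<^sup>2"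
        using sq[of i j] M[OF that(1)] M[OF that(2)] by (simp add: distrib_left)
      then show ?thesis using \<open>\<epsilon> > 0\<close> by (simp add: dist_norm power2_less_imp_less)
    qed
    then show "\<exists>M. \<forall>i\<ge>M. \<forall>j\<ge>M. dist (u i) (u j) < \<epsilon>" by blast
  qed
  then obtain s where s: "u \<longlonglongrightarrow> s" using Cauchy_convergent convergent_def by blast
  have "s \<in> V \<and> norm (T s) \<le> m"
    unfolding V_def T_def
    by (rule fcalc_lower_semicontinuous[OF \<phi> _ s _ lim])
      (use uK u in \<open>auto simp: K_def V_def T_def intro: less_imp_le\<close>)
  moreover have "inner s (e y) = inner f (e y)" if "y \<in> \<Lambda>" for y
  proof -
    have "(\<lambda>n. inner (u n) (e y)) \<longlonglongrightarrow> inner s (e y)" by (intro tendsto_intros s)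
    moreover have "inner (u n) (e y) = inner f (e y)" for n using uK that by (auto simp: K_def)
    ultimately show ?thesis by (simp add: LIMSEQ_const_iff)
  qed
  ultimately have sK: "s \<in> K" and Ts: "norm (T s) \<le> m" by (auto simp: K_def)
  \<comment> \<open>Two vectors at the infimum have equal images by \<open>par\<close>, and are then
    equal by coercivity.\<close>
  have uniq: "v = w" if "v \<in> K" "norm (T v) \<le> m" "w \<in> K" "norm (T w) \<le> m" for v w
  proof -
    have "(norm (T v))\<^sup>2 \<le> m\<^sup>2" "(norm (T w))\<^sup>2 \<le> m\<^sup>2"
      using that by (auto intro: power_mono)
    then have "(norm (T v - T w))\<^sup>2 \<le> 0" using par[OF that(1,3)] by linarith
    then show ?thesis using diffK[OF that(1,3)] by simp
  qed
  have "\<exists>!s. s \<in> K \<and> (\<forall>u\<in>K. norm (T s) \<le> norm (T u))"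
  proof (rule ex1I[of _ s])
    show "s \<in> K \<and> (\<forall>u\<in>K. norm (T s) \<le> norm (T u))"
      using sK Ts m_le order_trans by blast
    show "v = s" if "v \<in> K \<and> (\<forall>u\<in>K. norm (T v) \<le> norm (T u))" for v
      using that sK Ts by (intro uniq) (auto intro: order_trans)
  qed
  then show ?thesis unfolding K_def V_def T_def by (simp add: Ball_def conj_assoc imp_conjL)
qed

end

text \<open>The geometry enters only through the abstract inequality \<open>poincare\<close>, for
  vectors with vanishing samples.\<close>

lemma spline_error:
  fixes E :: "real set \<Rightarrow> 'a::metric_measure_space l2 \<Rightarrow> 'a l2"
  assumes E: "projection_valued_measure E" and f: "f \<in> PW E \<omega>" and k: "k \<ge> 1" and a: "a \<ge> 0"
    and poincare: "\<And>u. u \<in> half_power_dom E 1 \<Longrightarrow> (\<And>y. y \<in> \<Lambda> \<Longrightarrow> inner u (\<xi> \<rho> y) = 0) \<Longrightarrow>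
      norm u \<le> a * norm (half_power E 1 u)"
  shows "norm (f - spline E \<rho> \<Lambda> k f) \<le> 2 * (a * \<omega>) ^ k * norm f"
proof -
  interpret pvm E by unfold_locales (rule E)
  have coercive: "norm u \<le> a ^ k * norm (half_power E k u)"
    if "u \<in> half_power_dom E k" "\<And>y. y \<in> \<Lambda> \<Longrightarrow> inner u (\<xi> \<rho> y) = 0" for u
    by (rule norm_le_half_power[OF that(1) k a])
       (rule poincare[OF half_power_dom_mono[OF that(1) k] that(2)])
  have \<phi>: "(\<lambda>t. sqrt t ^ k) \<in> borel_measurable borel" by measurable
  have fk: "f \<in> half_power_dom E k" by (rule PW_half_power[OF f])
  define s where "s = spline E \<rho> \<Lambda> k f"
  have "s \<in> half_power_dom E k \<and> (\<forall>y\<in>\<Lambda>. inner s (\<xi> \<rho> y) = inner f (\<xi> \<rho> y)) \<and>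
     (\<forall>u\<in>half_power_dom E k. (\<forall>y\<in>\<Lambda>. inner u (\<xi> \<rho> y) = inner f (\<xi> \<rho> y)) \<longrightarrow>
        norm (half_power E k s) \<le> norm (half_power E k u))"
    \<comment> \<open>Unique existence turns the description in \<open>spline\<close> into an actual
      minimizer, with which \<open>f\<close> can then be compared as a competitor.\<close>
    unfolding s_def spline_def half_power_dom_def half_power_def
    by (rule theI', rule ex1_constrained_minimizer[OF \<phi>, of _ "a ^ k"])
       (use fk a coercive in \<open>auto simp: half_power_dom_def half_power_def\<close>)
  then have sk: "s \<in> half_power_dom E k" and s: "\<And>y. y \<in> \<Lambda> \<Longrightarrow> inner s (\<xi> \<rho> y) = inner f (\<xi> \<rho> y)"
    and s_min: "norm (half_power E k s) \<le> norm (half_power E k f)" using fk by auto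
  have "f - s \<in> half_power_dom E k"
    using fk sk fcalc_dom_subspace[OF \<phi>] by (simp add: half_power_dom_def subspace_diff)
  then have "norm (f - s) \<le> a ^ k * norm (half_power E k (f - s))"
    by (rule coercive) (simp add: s inner_diff_left)
  also have "half_power E k (f - s) = half_power E k f - half_power E k s"
    using fcalc_linear_combination[OF \<phi>, of f s 1 "-1"] fk sk
    by (simp add: half_power_dom_def half_power_def)
  also have "a ^ k * norm (half_power E k f - half_power E k s) \<le> a ^ k * (2 * (\<omega> ^ k * norm f))"
  proof (rule mult_left_mono)
    have "norm (half_power E k f - half_power E k s) \<le> 2 * norm (half_power E k f)"
      using norm_triangle_ineq4[of "half_power E k f" "half_power E k s"] s_min by linarith
    then show "norm (half_power E k f - half_power E k s) \<le> 2 * (\<omega> ^ k * norm f)"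
      using PW_half_power(2)[OF f, of k] by linarith
  qed (use a in simp)
  finally show ?thesis by (simp add: s_def power_mult_distrib mult_ac)
qed

section \<open>The Poincare inequality on a lattice\<close>

text \<open>Balls may fail to be relatively compact. Local compactness gives one small ball of
  finite measure about \<open>x\<close>, and repeated doubling carries finiteness to every
  radius.\<close>

lemma ball_measure_pos_finite:
  assumes "locally_compact_space (euclidean :: 'a::metric_measure_space topology)"
    and "radon_measure (mu :: 'a measure)" and d: "doubling d (mu :: 'a measure)" and r: "r > 0"
  shows "emeasure mu (ball (x :: 'a) r) < \<infinity>" "0 < measure mu (ball x r)"
proof -
  obtain U K where UK: "open U" "compact K" "x \<in> U" "U \<subseteq> K"
    using assms(1) unfolding locally_compact_space_def
    by simp (metis UNIV_I)
  obtain \<epsilon> where \<epsilon>: "\<epsilon> > 0" "ball x \<epsilon> \<subseteq> U" using UK by (meson openE)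
  have fin: "emeasure mu (ball x (2 ^ n * \<epsilon>)) < \<infinity>" for n
  proof (induction n)
    case 0
    have "K \<in> sets mu" using UK by (simp add: sets_mu borel_closed compact_imp_closed)
    then have "emeasure mu (ball x \<epsilon>) \<le> emeasure mu K" using UK \<epsilon> by (intro emeasure_mono) auto
    also have "\<dots> < \<infinity>" using assms(2) UK by (simp add: radon_measure_def)
    finally show ?case by simp
  next
    case (Suc n)
    have "emeasure mu (ball x (2 * (2 ^ n * \<epsilon>))) \<le> ennreal (2 powr d) * emeasure mu (ball x (2 ^ n * \<epsilon>))"
      using d \<epsilon> by (simp add: doubling_def)
    also have "\<dots> < \<infinity>" using Suc by (simp add: ennreal_mult_less_top)
    finally show ?case by (simp add: mult.assoc)
  qed
  obtain n where n: "r / \<epsilon> < 2 ^ n" using real_arch_pow[of 2 "r / \<epsilon>"] by auto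
  then have "r \<le> 2 ^ n * \<epsilon>" using \<epsilon> by (simp add: field_simps)
  then have "emeasure mu (ball x r) \<le> emeasure mu (ball x (2 ^ n * \<epsilon>))"
    by (intro emeasure_mono subset_ball) (auto simp: sets_mu)
  then show f: "emeasure mu (ball x r) < \<infinity>" using fin le_less_trans by blast
  have "0 < emeasure mu (ball x (2 * (r / 2)))" using d r unfolding doubling_def by (metis half_gt_zero)
  then show "0 < measure mu (ball x r)"
    using f by (simp add: measure_def enn2real_positive_iff)
qed

text \<open>Each half-radius ball contains a point of a countable dense set, and disjointness makes
  this choice injective.\<close>

lemma rho_lattice_countable:
  assumes "separable_space (euclidean :: 'a::metric_space topology)"
    and lat: "rho_lattice N \<rho> (\<Lambda> :: 'a set)" and "\<rho> > 0"
  shows "countable \<Lambda>"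
proof -
  obtain S :: "'a set" where S: "countable S" "closure S = UNIV"
    using assms(1) by (auto simp: separable_space_def)
  have "\<exists>s\<in>S. s \<in> ball y (\<rho> / 2)" for y
    using closure_approachableD[of y S "\<rho> / 2"] \<open>\<rho> > 0\<close> S(2) by (auto simp: dist_commute)
  then obtain g where g: "\<And>y. g y \<in> S" "\<And>y. g y \<in> ball y (\<rho> / 2)" by metis
  have "inj_on g \<Lambda>"
  proof (rule inj_onI, rule ccontr)
    fix y z assume "y \<in> \<Lambda>" "z \<in> \<Lambda>" "g y = g z" "y \<noteq> z"
    then have "ball y (\<rho> / 2) \<inter> ball z (\<rho> / 2) = {}"
      using lat by (auto simp: rho_lattice_def disjoint_family_on_def)
    then show False using g(2)[of y] g(2)[of z] \<open>g y = g z\<close> by auto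
  qed
  moreover have "countable (g ` \<Lambda>)" by (rule countable_subset[OF _ S(1)]) (use g in auto)
  ultimately show ?thesis using countable_image_inj_on by blast
qed

text \<open>Restriction as a map on classes, so that local norms can be carried through norm
  limits.\<close>

definition restrict_l2 :: "'a set \<Rightarrow> 'a::metric_measure_space l2 \<Rightarrow> 'a l2" where
  "restrict_l2 B f = cls (\<lambda>x. indicator B x * fn f x)"

lemma fn_restrict_l2:
  assumes "B \<in> sets borel"
  shows "AE x in mu. fn (restrict_l2 B f) x = indicator B x * fn f x"
proof -
  have [measurable]: "B \<in> sets mu" using assms by (simp add: sets_mu)
  have "integrable mu (\<lambda>x. indicator B x *\<^sub>R (fn f x)\<^sup>2)"
    by (intro integrable_mult_indicator integrable_fn_sq) simp
  also have "(\<lambda>x. indicator B x *\<^sub>R (fn f x)\<^sup>2) = (\<lambda>x. (indicator B x * fn f x)\<^sup>2)"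
    by (auto simp: indicator_def)
  finally have "square_integrable (\<lambda>x. indicator B x * fn f x)"
    by (simp add: square_integrable_def)
  then show ?thesis unfolding restrict_l2_def by (rule fn_cls)
qed

lemma norm_restrict_l2:
  assumes B: "B \<in> sets borel"
  shows "(norm (restrict_l2 B f))\<^sup>2 = (LINT x|mu. indicator B x * (fn f x)\<^sup>2)"
  unfolding norm_l2_sq
proof (rule integral_cong_AE)
  have [measurable]: "B \<in> sets mu" using B by (simp add: sets_mu)
  show "(\<lambda>x. indicator B x * (fn f x)\<^sup>2) \<in> borel_measurable mu" by measurable
  show "AE x in mu. (fn (restrict_l2 B f) x)\<^sup>2 = indicator B x * (fn f x)\<^sup>2"
    using fn_restrict_l2[OF B, of f] by eventually_elim (simp add: indicator_def)
qed measurable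

lemma dist_restrict_l2_le:
  assumes B: "B \<in> sets borel"
  shows "dist (restrict_l2 B f) (restrict_l2 B g) \<le> dist f g"
proof -
  have [measurable]: "B \<in> sets mu" using B by (simp add: sets_mu)
  have "(norm (restrict_l2 B f - restrict_l2 B g))\<^sup>2 \<le> (norm (f - g))\<^sup>2"
    unfolding norm_l2_sq
  proof (rule integral_mono_AE[OF integrable_fn_sq integrable_fn_sq])
    show "AE x in mu. (fn (restrict_l2 B f - restrict_l2 B g) x)\<^sup>2 \<le> (fn (f - g) x)\<^sup>2"
      using fn_restrict_l2[OF B, of f] fn_restrict_l2[OF B, of g]
        fn_diff[of "restrict_l2 B f" "restrict_l2 B g"] fn_diff[of f g]
      by eventually_elim (simp add: indicator_def)
  qed
  then show ?thesis by (auto simp: dist_norm intro: power2_le_imp_le)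
qed

lemma tendsto_restrict_l2:
  assumes "B \<in> sets borel" "X \<longlonglongrightarrow> f"
  shows "(\<lambda>n. restrict_l2 B (X n)) \<longlonglongrightarrow> restrict_l2 B f"
proof (rule metric_tendsto_imp_tendsto[OF assms(2)])
  show "\<forall>\<^sub>F n in sequentially. dist (restrict_l2 B (X n)) (restrict_l2 B f) \<le> dist (X n) f"
    using dist_restrict_l2_le[OF assms(1)] by simp
qed

text \<open>The variance is the second moment minus the squared integral divided by the measure of
  the ball. The normalization of \<open>\<xi>\<close> makes the subtracted term the squared
  sample.\<close>

lemma ball_variance:
  fixes f :: "'a::metric_measure_space l2" and x :: 'a and r :: real
  defines "B \<equiv> ball x r"
  assumes fin: "emeasure mu B < \<infinity>" and pos: "0 < measure mu B"
  shows "(LINT y:B|mu. (fn f y - ball_mean f B)\<^sup>2) = (norm (restrict_l2 B f))\<^sup>2 - (inner f (\<xi> r x))\<^sup>2"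
proof -
  have B: "B \<in> sets borel" by (simp add: B_def)
  then have [measurable]: "B \<in> sets mu" by (simp add: sets_mu)
  define b where "b = measure mu B"
  define I where "I = (LINT y|mu. indicator B y * fn f y)"
  have indB: "integrable mu (indicator B :: 'a \<Rightarrow> real)"
    using fin by simp
  have ind_sq: "square_integrable (\<lambda>y. c * indicator B y)" for c :: real
    by (rule square_integrable_scale) (use indB in \<open>simp add: square_integrable_def power2_eq_square flip: indicator_inter_arith\<close>)
  have int1: "integrable mu (\<lambda>y. indicator B y * fn f y)"
    using square_integrable_mult[OF ind_sq[of 1] square_integrable_fn[of f]] by simp
  have int2: "integrable mu (\<lambda>y. indicator B y * (fn f y)\<^sup>2)"
    using integrable_mult_indicator[OF _ integrable_fn_sq, of B f] by simp
  have mean: "ball_mean f B = I / b"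
    by (simp add: ball_mean_def I_def b_def set_lebesgue_integral_def)
  have "(LINT y:B|mu. (fn f y - ball_mean f B)\<^sup>2)
    = (LINT y|mu. indicator B y * (fn f y)\<^sup>2 - 2 * (I / b) * (indicator B y * fn f y) + (I / b)\<^sup>2 * indicator B y)"
    unfolding set_lebesgue_integral_def mean
    by (rule Bochner_Integration.integral_cong) (auto simp: power2_eq_square algebra_simps)
  also have "\<dots> = (norm (restrict_l2 B f))\<^sup>2 - 2 * (I / b) * I + (I / b)\<^sup>2 * b"
    using int1 int2 indB by (simp add: norm_restrict_l2[OF B] I_def b_def)
  also have "\<dots> = (norm (restrict_l2 B f))\<^sup>2 - I\<^sup>2 / b"
    using pos by (simp add: b_def power2_eq_square field_simps)
  also have "I\<^sup>2 / b = (inner f (\<xi> r x))\<^sup>2"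
  proof -
    have "inner f (\<xi> r x) = (LINT y|mu. fn f y * (b powr (- 1 / 2) * indicator B y))"
      unfolding inner_l2_fn
    proof (rule integral_cong_AE)
      show "AE y in mu. fn f y * fn (\<xi> r x) y = fn f y * (b powr (- 1 / 2) * indicator B y)"
        using fn_cls[OF ind_sq[of "b powr (- 1 / 2)"]]
        by eventually_elim (simp add: \<xi>_def b_def B_def)
    qed measurable
    also have "\<dots> = (LINT y|mu. b powr (- 1 / 2) * (indicator B y * fn f y))"
      by (simp add: mult_ac)
    also have "\<dots> = b powr (- 1 / 2) * I" by (simp add: I_def)
    finally have "(inner f (\<xi> r x))\<^sup>2 = (b powr (- 1 / 2) * b powr (- 1 / 2)) * I\<^sup>2"
      by (simp add: power2_eq_square mult_ac)
    also have "b powr (- 1 / 2) * b powr (- 1 / 2) = 1 / b"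
      using pos by (simp add: powr_add[symmetric] b_def powr_minus_divide)
    finally show ?thesis by simp
  qed
  finally show ?thesis .
qed

text \<open>Integrate the number of balls covering a point, which is at most
  \<open>N\<close>.\<close>

lemma sum_measure_lattice_balls_le:
  fixes \<Lambda> :: "'a::metric_space set"
  assumes fin: "emeasure M UNIV < \<infinity>" and sets: "sets M = sets borel"
    and lat: "rho_lattice N \<rho> \<Lambda>" and F: "finite F" "F \<subseteq> \<Lambda>"
  shows "(\<Sum>y\<in>F. measure M (ball y \<rho>)) \<le> real N * measure M UNIV"
proof -
  have space: "space M = UNIV" using sets_eq_imp_space_eq[OF sets] by simp
  interpret finite_measure M by (rule finite_measureI) (use fin space in simp)
  have [simp]: "ball y \<rho> \<in> sets M" for y by (simp add: sets)
  have "(\<Sum>y\<in>F. measure M (ball y \<rho>)) = (LINT x|M. (\<Sum>y\<in>F. indicator (ball y \<rho>) x))"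
    by (simp add: Bochner_Integration.integral_sum less_top[symmetric] space)
  also have "\<dots> \<le> (LINT x|M. real N)"
  proof (rule integral_mono)
    fix x
    have "(\<Sum>y\<in>F. indicator (ball y \<rho>) x) = real (card {y\<in>F. x \<in> ball y \<rho>})"
      using F by (simp add: indicator_def sum.If_cases Int_def)
    also have "card {y\<in>F. x \<in> ball y \<rho>} \<le> card {y\<in>\<Lambda>. x \<in> ball y \<rho>}"
      using lat F by (intro card_mono) (auto simp: rho_lattice_def)
    also have "\<dots> \<le> N" using lat by (simp add: rho_lattice_def)
    finally show "(\<Sum>y\<in>F. indicator (ball y \<rho>) x) \<le> real N" by simp
  qed (auto simp: less_top[symmetric])
  also have "\<dots> = real N * measure M UNIV" by (simp add: space)
  finally show ?thesis .
qed

text \<open>Finite unions of the sets exhaust the space, and the indicator of a union is at most the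
  sum of the indicators.\<close>

lemma norm_sq_le_if_sum_restrict_le:
  fixes u :: "'a::metric_measure_space l2"
  assumes \<Lambda>: "countable \<Lambda>" "(\<Union>y\<in>\<Lambda>. B y) = UNIV" and B: "\<And>y. B y \<in> sets borel"
    and le: "\<And>F. finite F \<Longrightarrow> F \<subseteq> \<Lambda> \<Longrightarrow> (\<Sum>y\<in>F. (norm (restrict_l2 (B y) u))\<^sup>2) \<le> c"
  shows "(norm u)\<^sup>2 \<le> c"
proof -
  have [measurable]: "B y \<in> sets mu" for y using B by (simp add: sets_mu)
  have ne: "\<Lambda> \<noteq> {}" using \<Lambda>(2) by auto
  \<comment> \<open>The enumeration repeats points when \<Lambda> is finite; taking images as sets
    makes this harmless.\<close>
  define F where "F n = from_nat_into \<Lambda> ` {..<n}" for n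
  have F: "finite (F n)" "F n \<subseteq> \<Lambda>" for n using from_nat_into[OF ne] by (auto simp: F_def)
  define U where "U n = (\<Union>y\<in>F n. B y)" for n
  have [measurable]: "U n \<in> sets mu" for n unfolding U_def using F by auto
  have int: "integrable mu (\<lambda>x. indicator A x * (fn u x)\<^sup>2)" if "A \<in> sets mu" for A
    using integrable_mult_indicator[OF that integrable_fn_sq, of u] by simp
  have "(\<lambda>n. LINT x|mu. indicator (U n) x * (fn u x)\<^sup>2) \<longlonglongrightarrow> (LINT x|mu. (fn u x)\<^sup>2)"
  proof (rule integral_dominated_convergence[where w = "\<lambda>x. (fn u x)\<^sup>2"])
    show "AE x in mu. (\<lambda>n. indicator (U n) x * (fn u x)\<^sup>2) \<longlonglongrightarrow> (fn u x)\<^sup>2"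
    proof (rule AE_I2)
      fix x
      obtain y where y: "y \<in> \<Lambda>" "x \<in> B y" using \<Lambda>(2) by blast
      obtain i where i: "from_nat_into \<Lambda> i = y" using from_nat_into_surj[OF \<Lambda>(1) y(1)] by auto
      have "indicator (U n) x * (fn u x)\<^sup>2 = (fn u x)\<^sup>2" if "n \<ge> Suc i" for n
        using that y i by (auto simp: U_def F_def indicator_def)
      then show "(\<lambda>n. indicator (U n) x * (fn u x)\<^sup>2) \<longlonglongrightarrow> (fn u x)\<^sup>2"
        by (intro tendsto_eventually) (auto simp: eventually_sequentially)
    qed
    show "AE x in mu. norm (indicator (U n) x * (fn u x)\<^sup>2) \<le> (fn u x)\<^sup>2" for n
      by (simp add: indicator_def)
  qed (use integrable_fn_sq in auto)
  moreover have "(LINT x|mu. indicator (U n) x * (fn u x)\<^sup>2) \<le> c" for n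
  proof -
    have "(LINT x|mu. indicator (U n) x * (fn u x)\<^sup>2) \<le> (LINT x|mu. (\<Sum>y\<in>F n. indicator (B y) x * (fn u x)\<^sup>2))"
    proof (rule integral_mono)
      fix x
      have "indicator (U n) x \<le> (\<Sum>y\<in>F n. indicator (B y) x :: real)"
      proof (cases "x \<in> U n")
        case True
        then obtain y where "y \<in> F n" "x \<in> B y" by (auto simp: U_def)
        then show ?thesis
          using member_le_sum[OF \<open>y \<in> F n\<close> _ F(1), of "\<lambda>y. indicator (B y) x :: real"] True by simp
      qed (simp add: sum_nonneg)
      then show "indicator (U n) x * (fn u x)\<^sup>2 \<le> (\<Sum>y\<in>F n. indicator (B y) x * (fn u x)\<^sup>2)"
        unfolding sum_distrib_right[symmetric] by (rule mult_right_mono) simp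
    qed (auto intro!: int Bochner_Integration.integrable_sum)
    also have "\<dots> = (\<Sum>y\<in>F n. (norm (restrict_l2 (B y) u))\<^sup>2)"
      by (simp add: Bochner_Integration.integral_sum int norm_restrict_l2 B)
    also have "\<dots> \<le> c" by (rule le[OF F])
    finally show ?thesis .
  qed
  ultimately show ?thesis unfolding norm_l2_sq by (intro LIMSEQ_le_const2) auto
qed

text \<open>On each ball the variance of \<open>u\<close> is its full squared norm because the
  sample vanishes. The left sides of the local inequalities add up by covering, the right sides by
  bounded multiplicity.\<close>

lemma norm_le_form_if_samples_zero:
  fixes E :: "real set \<Rightarrow> 'a::metric_measure_space l2 \<Rightarrow> 'a l2"
  assumes E: "projection_valued_measure E" and D: "D = fcalc_dom E (\<lambda>t. t)"
    and \<Gamma>: "energy_measure E \<Gamma>" and P: "local_poincare D \<Gamma> C r0" and "C > 0"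
    and balls: "\<And>y::'a. emeasure mu (ball y \<rho>) < \<infinity>" "\<And>y::'a. 0 < measure mu (ball y \<rho>)"
    and \<rho>: "0 < \<rho>" "\<rho> \<le> r0" and lat: "rho_lattice N \<rho> \<Lambda>" and "countable \<Lambda>"
    and u: "u \<in> half_power_dom E 1" and zero: "\<And>y. y \<in> \<Lambda> \<Longrightarrow> inner u (\<xi> \<rho> y) = 0"
  shows "norm u \<le> sqrt (C * real N) * \<rho> * norm (half_power E 1 u)"
proof -
  interpret pvm E by unfold_locales (rule E)
  define c where "c = C * real N * \<rho>\<^sup>2"
  have c: "c \<ge> 0" using \<open>C > 0\<close> by (simp add: c_def)
  \<comment> \<open>The sample terms are kept: the truncations of \<open>u\<close> used below need
    not have vanishing samples, and these terms disappear only in the limit.\<close>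
  have D_le: "(\<Sum>y\<in>F. (norm (restrict_l2 (ball y \<rho>) f))\<^sup>2 - (inner f (\<xi> \<rho> y))\<^sup>2)
      \<le> c * (norm (half_power E 1 f))\<^sup>2"
    if f: "f \<in> D" "f \<in> half_power_dom E 1" and F: "finite F" "F \<subseteq> \<Lambda>" for f F
  proof -
    have \<Gamma>f: "sets (\<Gamma> f) = sets borel" "emeasure (\<Gamma> f) UNIV = ennreal ((norm (half_power E 1 f))\<^sup>2)"
      using \<Gamma> f(2) by (auto simp: energy_measure_def form_dom_def form_def power2_norm_eq_inner)
    have "(\<Sum>y\<in>F. (norm (restrict_l2 (ball y \<rho>) f))\<^sup>2 - (inner f (\<xi> \<rho> y))\<^sup>2)
        = (\<Sum>y\<in>F. LINT z:ball y \<rho>|mu. (fn f z - ball_mean f (ball y \<rho>))\<^sup>2)"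
      using ball_variance[OF balls] by simp
    also have "\<dots> \<le> (\<Sum>y\<in>F. C * \<rho>\<^sup>2 * measure (\<Gamma> f) (ball y \<rho>))"
      using P f(1) \<rho> by (intro sum_mono) (simp add: local_poincare_def)
    also have "\<dots> = C * \<rho>\<^sup>2 * (\<Sum>y\<in>F. measure (\<Gamma> f) (ball y \<rho>))"
      by (simp add: sum_distrib_left)
    also have "\<dots> \<le> C * \<rho>\<^sup>2 * (real N * measure (\<Gamma> f) UNIV)"
      using \<open>C > 0\<close> by (intro mult_left_mono sum_measure_lattice_balls_le[OF _ _ lat F]) (auto simp: \<Gamma>f)
    also have "\<dots> = c * (norm (half_power E 1 f))\<^sup>2"
      by (simp add: measure_def \<Gamma>f c_def)
    finally show ?thesis .
  qed
  define A where "A n = {t::real. \<bar>t\<bar> \<le> real n}" for n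
  have A [measurable]: "A n \<in> sets borel" for n unfolding A_def by measurable
  \<comment> \<open>The Poincare inequality is assumed on \<open>D\<close> only; \<open>u\<close> is reached by spectral truncation, along
    which the form does not increase.\<close>
  define X where "X n = E (A n) u" for n
  have "incseq A" by (auto simp: A_def incseq_def)
  moreover have "(\<Union>n. A n) = UNIV" by (auto simp: A_def real_arch_simple)
  ultimately have X: "X \<longlonglongrightarrow> u" unfolding X_def by (intro E_exhaustion) auto
  have XD: "X n \<in> D" for n
    unfolding X_def D by (rule E_bounded_in_fcalc_dom[OF _ A, of _ _ "real n"]) (auto simp: A_def)
  have X1: "X n \<in> half_power_dom E 1 \<and> norm (half_power E 1 (X n)) \<le> norm (half_power E 1 u)" for n
    using u unfolding half_power_dom_def half_power_def X_def
    by (intro norm_fcalc_E_le) auto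
  have "(norm u)\<^sup>2 \<le> c * (norm (half_power E 1 u))\<^sup>2"
  proof (rule norm_sq_le_if_sum_restrict_le)
    show "(\<Union>y\<in>\<Lambda>. ball y \<rho>) = UNIV" using lat by (simp add: rho_lattice_def)
    fix F assume F: "finite F" "F \<subseteq> \<Lambda>"
    have "(\<lambda>n. \<Sum>y\<in>F. (norm (restrict_l2 (ball y \<rho>) (X n)))\<^sup>2 - (inner (X n) (\<xi> \<rho> y))\<^sup>2)
      \<longlonglongrightarrow> (\<Sum>y\<in>F. (norm (restrict_l2 (ball y \<rho>) u))\<^sup>2 - (inner u (\<xi> \<rho> y))\<^sup>2)"
      by (intro tendsto_intros tendsto_restrict_l2 X) simp
    also have "(\<Sum>y\<in>F. (norm (restrict_l2 (ball y \<rho>) u))\<^sup>2 - (inner u (\<xi> \<rho> y))\<^sup>2)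
      = (\<Sum>y\<in>F. (norm (restrict_l2 (ball y \<rho>) u))\<^sup>2)"
      using F zero by (intro sum.cong) auto
    finally show "(\<Sum>y\<in>F. (norm (restrict_l2 (ball y \<rho>) u))\<^sup>2) \<le> c * (norm (half_power E 1 u))\<^sup>2"
    proof (rule LIMSEQ_le_const2, intro exI allI impI)
      fix n
      have "c * (norm (half_power E 1 (X n)))\<^sup>2 \<le> c * (norm (half_power E 1 u))\<^sup>2"
        using X1 c by (intro mult_left_mono power_mono) auto
      then show "(\<Sum>y\<in>F. (norm (restrict_l2 (ball y \<rho>) (X n)))\<^sup>2 - (inner (X n) (\<xi> \<rho> y))\<^sup>2)
          \<le> c * (norm (half_power E 1 u))\<^sup>2"
        using D_le[OF XD _ F] X1 order_trans by blast
    qed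
  qed (use \<open>countable \<Lambda>\<close> in auto)
  also have "\<dots> = (sqrt (C * real N) * \<rho> * norm (half_power E 1 u))\<^sup>2"
    using \<open>C > 0\<close> by (simp add: c_def power_mult_distrib)
  finally show ?thesis
    by (rule power2_le_imp_le) (use \<open>C > 0\<close> \<rho> in simp)
qed

section \<open>Convergence of the splines and uniqueness\<close>

lemma C1_antimono:
  assumes "C \<ge> 0" "0 < j" "j \<le> k"
  shows "C1 C N k \<le> C1 C N j"
proof (cases "k = 0")
  case False
  then have "2 powr (1 / real k) \<le> (2::real) powr (1 / real j)"
    using assms by (intro powr_mono) (auto simp: field_simps)
  then show ?thesis unfolding C1_def
    by (rule mult_right_mono) (use assms in simp)
qed (use assms in simp)

text \<open>As \<open>C1\<close> varies with the spline order, a starting order \<kappa> fixes the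
  smallness condition on \<rho>, and each later order has its own rate. The threshold
  \<open>\<rho>0\<close> is chosen before the frequency, the order and the lattice.\<close>

theorem theorem5p7:
  fixes D :: "'a::metric_measure_space l2 set"
    and L :: "'a l2 \<Rightarrow> 'a l2"
    and E :: "real set \<Rightarrow> 'a l2 \<Rightarrow> 'a l2"
    and \<Gamma> :: "'a l2 \<Rightarrow> 'a measure"
    and d C r0 :: real and N k0 :: nat
  assumes "locally_compact_space (euclidean :: 'a topology)"
    and "separable_space (euclidean :: 'a topology)"
    and "radon_measure (mu :: 'a measure)"
    and "d > 0" and "doubling d (mu :: 'a measure)"
    and "self_adjoint D L" and "nonneg_operator D L"
    and "spectral_resolution D L E"
    and "dirichlet_form E" and "regular_form E" and "strongly_local E"
    and "energy_measure E \<Gamma>"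
    and "C > 0" and "r0 > 0" and "local_poincare D \<Gamma> C r0"
    and "\<exists>\<rho>1>0. \<forall>\<rho>. 0 < \<rho> \<and> \<rho> < \<rho>1 \<longrightarrow> (\<exists>\<Lambda>::'a set. rho_lattice N \<rho> \<Lambda>)"
    and "sampling_surjective E N k0"
  shows "\<exists>\<rho>0>0. \<forall>\<omega>>0. \<forall>\<kappa>>k0. \<forall>\<rho> \<Lambda>.
    0 < \<rho> \<and> \<rho> < \<rho>0 \<and> \<rho> < 1 / (C1 C N \<kappa> * \<omega>) \<and> rho_lattice N \<rho> \<Lambda> \<longrightarrow>
      (\<forall>f\<in>PW E \<omega>. \<forall>g\<in>PW E \<omega>.
         (\<forall>y\<in>\<Lambda>. inner f (\<xi> \<rho> y) = inner g (\<xi> \<rho> y)) \<longrightarrow> f = g) \<and>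
      (\<forall>f\<in>PW E \<omega>.
         (\<lambda>k. spline E \<rho> \<Lambda> k f) \<longlonglongrightarrow> f \<and>
         (\<forall>k\<ge>\<kappa>. let \<gamma> = C1 C N k * \<rho> * \<omega> in
            \<gamma> < 1 \<and> norm (f - spline E \<rho> \<Lambda> k f) \<le> \<gamma> ^ k * norm f))"
proof -
  have E: "projection_valued_measure E" and D: "D = fcalc_dom E (\<lambda>t. t)"
    using assms(8) by (simp_all add: spectral_resolution_def)
  have main: "(\<lambda>k. spline E \<rho> \<Lambda> k f) \<longlonglongrightarrow> f \<and>
      (\<forall>k\<ge>\<kappa>. C1 C N k * \<rho> * \<omega> < 1 \<and>
        norm (f - spline E \<rho> \<Lambda> k f) \<le> (C1 C N k * \<rho> * \<omega>) ^ k * norm f)"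
    if \<omega>: "\<omega> > 0" and \<kappa>: "\<kappa> > k0" and \<rho>: "0 < \<rho>" "\<rho> < r0" "\<rho> < 1 / (C1 C N \<kappa> * \<omega>)"
      and lat: "rho_lattice N \<rho> \<Lambda>" and f: "f \<in> PW E \<omega>"
    for \<omega> \<kappa> \<rho> \<Lambda> f
  proof -
    define a where "a = sqrt (C * real N) * \<rho>"
    have a: "a \<ge> 0" using \<open>C > 0\<close> \<rho> by (simp add: a_def)
    define \<gamma> where "\<gamma> k = C1 C N k * \<rho> * \<omega>" for k
    have \<gamma>0: "0 \<le> \<gamma> k" for k
      using \<open>C > 0\<close> \<rho> \<omega> by (simp add: \<gamma>_def C1_def)
    \<comment> \<open>\<open>C1\<close> decreases with the order, so smallness at \<kappa> persists
      for all later orders.\<close>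
    have \<gamma>_mono: "\<gamma> k \<le> \<gamma> \<kappa>" if "k \<ge> \<kappa>" for k
      unfolding \<gamma>_def using \<open>C > 0\<close> \<rho> \<omega> \<kappa> that by (intro mult_right_mono C1_antimono) auto
    \<comment> \<open>Positivity is read off the hypothesis: were the product zero,
      \<open>1 / 0 = 0\<close> would contradict \<open>0 < \<rho>\<close>.\<close>
    have "C1 C N \<kappa> * \<omega> > 0"
      using \<rho> by (metis less_trans zero_less_divide_1_iff)
    then have \<gamma>1: "\<gamma> \<kappa> < 1"
      using \<rho>(3) by (simp add: \<gamma>_def field_simps)
    have error: "norm (f - spline E \<rho> \<Lambda> k f) \<le> \<gamma> k ^ k * norm f" if k: "k \<ge> \<kappa>" for k
    proof -
      have "norm (f - spline E \<rho> \<Lambda> k f) \<le> 2 * (a * \<omega>) ^ k * norm f"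
      proof (rule spline_error[OF E f _ a])
        show "norm u \<le> a * norm (half_power E 1 u)"
          if "u \<in> half_power_dom E 1" "\<And>y. y \<in> \<Lambda> \<Longrightarrow> inner u (\<xi> \<rho> y) = 0" for u
          unfolding a_def
        proof (rule norm_le_form_if_samples_zero[OF E D _ _ _ _ _ _ _ lat _ that])
          show "emeasure mu (ball y \<rho>) < \<infinity>" "0 < measure mu (ball y \<rho>)" for y :: 'a
            using ball_measure_pos_finite[OF assms(1,3,5) \<rho>(1)] by auto
          show "countable \<Lambda>" by (rule rho_lattice_countable[OF assms(2) lat \<rho>(1)])
        qed (use assms \<rho> in auto)
      qed (use k \<kappa> in auto)
      \<comment> \<open>The \<open>k\<close>-th power of \<open>2 powr (1 / real k)\<close> is
        \<open>2\<close> because \<open>k\<close> is positive, being at least \<kappa>.\<close>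
      also have "2 * (a * \<omega>) ^ k = \<gamma> k ^ k"
        using k \<kappa> by (simp add: \<gamma>_def C1_def a_def power_mult_distrib powr_power)
      finally show ?thesis .
    qed
    have lim0: "(\<lambda>k. \<gamma> \<kappa> ^ k * norm f) \<longlonglongrightarrow> 0 * norm f"
      by (intro tendsto_intros LIMSEQ_realpow_zero \<gamma>0 \<gamma>1)
    have "\<forall>\<^sub>F k in sequentially. norm (f - spline E \<rho> \<Lambda> k f) \<le> \<gamma> \<kappa> ^ k * norm f"
      using eventually_ge_at_top[of \<kappa>]
    proof eventually_elim
      case (elim k)
      \<comment> \<open>The rate depends on \<open>k\<close>; replacing its base by the fixed
        \<open>\<gamma> \<kappa>\<close> gives a genuine geometric sequence.\<close>
      have "\<gamma> k ^ k * norm f \<le> \<gamma> \<kappa> ^ k * norm f"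
        by (intro mult_right_mono power_mono \<gamma>_mono \<gamma>0 elim) simp
      with error[OF elim] show ?case by linarith
    qed
    then have "(\<lambda>k. f - spline E \<rho> \<Lambda> k f) \<longlonglongrightarrow> 0"
      by (rule Lim_null_comparison) (use lim0 in simp)
    then have "(\<lambda>k. f - (f - spline E \<rho> \<Lambda> k f)) \<longlonglongrightarrow> f - 0"
      by (rule tendsto_diff[OF tendsto_const])
    then have "(\<lambda>k. spline E \<rho> \<Lambda> k f) \<longlonglongrightarrow> f" by simp
    moreover have "\<gamma> k < 1" if "k \<ge> \<kappa>" for k using \<gamma>_mono[OF that] \<gamma>1 by linarith
    ultimately show ?thesis using error by (simp add: \<gamma>_def)
  qed
  show ?thesis
  \<comment> \<open>The witness \<open>r0\<close> is the largest radius for which the local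
    inequality is assumed.\<close>
  proof (intro exI[of _ r0] conjI allI impI ballI)
    fix \<omega> :: real and \<kappa> :: nat and \<rho> :: real and \<Lambda> :: "'a set"
    assume \<omega>: "\<omega> > 0" and \<kappa>: "\<kappa> > k0"
      and "0 < \<rho> \<and> \<rho> < r0 \<and> \<rho> < 1 / (C1 C N \<kappa> * \<omega>) \<and> rho_lattice N \<rho> \<Lambda>"
    then have *: "0 < \<rho>" "\<rho> < r0" "\<rho> < 1 / (C1 C N \<kappa> * \<omega>)" "rho_lattice N \<rho> \<Lambda>" by auto
    note m = main[OF \<omega> \<kappa> *]
    show "f = g" if "f \<in> PW E \<omega>" "g \<in> PW E \<omega>" "\<forall>y\<in>\<Lambda>. inner f (\<xi> \<rho> y) = inner g (\<xi> \<rho> y)" for f g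
    proof -
      \<comment> \<open>A spline sees its argument only through the samples, so \<open>f\<close> and
        \<open>g\<close> are limits of the same sequence.\<close>
      have "spline E \<rho> \<Lambda> k f = spline E \<rho> \<Lambda> k g" for k
        using that(3) by (simp add: spline_def)
      then show ?thesis using LIMSEQ_unique conjunct1[OF m[OF that(1)]] conjunct1[OF m[OF that(2)]] by simp
    qed
    show "(\<lambda>k. spline E \<rho> \<Lambda> k f) \<longlonglongrightarrow> f" if "f \<in> PW E \<omega>" for f
      using m[OF that] by simp
    show "let \<gamma> = C1 C N k * \<rho> * \<omega> in \<gamma> < 1 \<and> norm (f - spline E \<rho> \<Lambda> k f) \<le> \<gamma> ^ k * norm f"
      if "f \<in> PW E \<omega>" "k \<ge> \<kappa>" for f k
      using m[OF that(1)] that(2) by (simp add: Let_def)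
  qed (use assms in simp)
qed

end
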